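(* Let $f$ be a holomorphic function on the open unit disc $\mathbb{D}\subset\mathbb{C}$. The function $f$ extends to a continuous function on $\overline{\mathbb{D}}$ whose boundary function $e^{i\theta}\mapsto f(e^{i\theta})$ on $\partial\mathbb{D}$ is log-Dini continuous if and only if there exists a positive non-increasing function $\Phi:[0,r_0)\to[0,+\infty]$, for some $r_0\in(0,1)$, such that: (a) the function $x\mapsto(\log(1/x))^n\,\Phi(x)$ is of class $L^1([0,r_0))$ (with respect to Lebesgue measure) for each $n\in\mathbb{N}$; and (b) $|f'(re^{i\theta})|\leq\Phi(1-r)$ for all $r\in(1-r_0,1)$ and for every $\theta\in\mathbb{R}$. Furthermore, whenever this happens (i.e. whenever $\Phi$ is such a function satisfying (a) and (b)), denoting by $f^{\bullet}$ the restriction to $\partial\mathbb{D}$ of the continuous extension of $f$, the modulus of continuity of $f^{\bullet}$ satisfies $$\omega_{f^{\bullet}}(\delta)\ \leq\ 3\int_0^{\delta}\Phi(x)\,dx\qquad\text{for } 0\leq\delta<r_0.$$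
   Context: Modulus of continuity: for $g:\partial\mathbb{D}\to\mathbb{C}$, $$\omega_g(\delta):=\sup_{|\theta-\phi|\leq\delta}|g(e^{i\theta})-g(e^{i\phi})|,\qquad 0\leq\delta\leq\pi.$$ Log-Dini continuity: a continuous function $g:\partial\mathbb{D}\to\mathbb{C}$ is log-Dini continuous if $$\int_0^1(\log(1/x))^n\,\frac{\omega_g(x)}{x}\,dx<\infty\qquad\text{for } n=0,1,2,\dots$$ *)

theory Defs
  imports "HOL-Complex_Analysis.Complex_Analysis"
begin

text \<open>
  A function on the unit circle is represented by a function on \<^typ>\<open>complex\<close> of which only the
  values on \<^term>\<open>sphere (0::complex) 1\<close> matter. The modulus of continuity takes values in
  \<^typ>\<open>ennreal\<close>, so the supremum makes sense for unbounded functions too.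
\<close>

definition modulus_of_continuity :: "(complex \<Rightarrow> complex) \<Rightarrow> real \<Rightarrow> ennreal" where
  "modulus_of_continuity g \<delta> =
     (SUP (\<theta>, \<phi>) \<in> {(\<theta>, \<phi>). \<bar>\<theta> - \<phi>\<bar> \<le> \<delta>}. ennreal (cmod (g (cis \<theta>) - g (cis \<phi>))))"

definition log_Dini_continuous :: "(complex \<Rightarrow> complex) \<Rightarrow> bool" where
  "log_Dini_continuous g \<longleftrightarrow>
     continuous_on (sphere 0 1) g \<and>
     (\<forall>n::nat. (\<integral>\<^sup>+ x. ennreal (ln (1 / x) ^ n) * (modulus_of_continuity g x / ennreal x)
                  \<partial>lebesgue_on {0<..<1}) < \<infinity>)"

definition continuous_extension_to_closed_disc ::
    "(complex \<Rightarrow> complex) \<Rightarrow> (complex \<Rightarrow> complex) \<Rightarrow> bool" where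
  "continuous_extension_to_closed_disc f F \<longleftrightarrow>
     continuous_on (cball 0 1) F \<and> (\<forall>z\<in>ball 0 1. F z = f z)"

definition L1_on :: "real set \<Rightarrow> (real \<Rightarrow> ennreal) \<Rightarrow> bool" where
  "L1_on A h \<longleftrightarrow> h \<in> borel_measurable (lebesgue_on A) \<and> (\<integral>\<^sup>+ x. h x \<partial>lebesgue_on A) < \<infinity>"

text \<open>
  Only the values of \<open>\<Phi>\<close> on \<^term>\<open>{0..<r0::real}\<close> matter. The integrand in the \<open>L\<^sup>1\<close> condition has a
  conventional value at \<open>x = 0\<close> (where \<open>ln (1 / 0) = 0\<close>), which is irrelevant as \<open>{0}\<close> is a null set.
\<close>

definition log_Dini_majorant ::
    "(complex \<Rightarrow> complex) \<Rightarrow> real \<Rightarrow> (real \<Rightarrow> ennreal) \<Rightarrow> bool" where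
  "log_Dini_majorant f r0 \<Phi> \<longleftrightarrow>
     0 < r0 \<and> r0 < 1 \<and>
     (\<forall>x\<in>{0..<r0}. 0 < \<Phi> x) \<and>
     antimono_on {0..<r0} \<Phi> \<and>
     (\<forall>n::nat. L1_on {0..<r0} (\<lambda>x. ennreal (ln (1 / x) ^ n) * \<Phi> x)) \<and>
     (\<forall>r\<in>{1 - r0<..<1}. \<forall>\<theta>::real. ennreal (cmod (deriv f (of_real r * cis \<theta>))) \<le> \<Phi> (1 - r))"

end

theory Submission imports Defs begin

text \<open>
  A majorant \<open>\<Phi>\<close> controls the oscillation of \<open>f\<close> along radii, so the circles of radius \<open>r < 1\<close>
  converge uniformly to the boundary; joining two boundary points at distance at most \<open>\<delta>\<close> by two
  radial segments and an arc of radius \<open>1 - \<delta>\<close> gives the modulus bound, each piece contributing at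
  most the integral of \<open>\<Phi>\<close> over \<open>[0, \<delta>]\<close> (for the arc, because \<open>\<delta> * \<Phi> \<delta>\<close> is at most that
  integral). By Tonelli, dividing a primitive by \<open>x\<close> costs one more logarithm, hence the log-Dini
  condition.

  Conversely, Cauchy's formula for the derivative, with the boundary value at the nearest point
  subtracted, bounds \<open>f'\<close> at distance \<open>x\<close> from the circle by the integral of \<open>\<omega> t / (max x t)\<^sup>2\<close> up to
  a constant. This is nonincreasing in \<open>x\<close>, and Tonelli together with the estimate
  \<open>O(t * (ln (1 / t) + n) ^ n)\<close> for the integral of \<open>ln (1 / x) ^ n\<close> over \<open>[0, t]\<close> shows that it
  satisfies the integrability conditions.
\<close>

section \<open>Integrals of monotone functions and of powers of the logarithm\<close>

text \<open>Completing the measure does not change the integral, so every estimate can be carried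
  out over \<open>lborel\<close>, where Tonelli's theorem is applied.\<close>

lemma nn_integral_lebesgue_on:
  fixes h :: "real \<Rightarrow> ennreal"
  assumes "S \<in> sets borel"
  shows "nn_integral (lebesgue_on S) h = (\<integral>\<^sup>+x\<in>S. h x \<partial>lborel)"
  using assms by (simp add: nn_integral_restrict_space nn_integral_completion)

lemma divide_ennreal_conv_mult:
  fixes w :: ennreal
  assumes "0 < x"
  shows "w / ennreal x = ennreal (1 / x) * w"
  using assms by (simp add: divide_ennreal_def inverse_ennreal inverse_eq_divide mult.commute)

text \<open>Superlevel sets of a monotone function are intervals. This and its decreasing twin
  supply all the measurability needed for moduli, primitives and majorants.\<close>

lemma borel_measurable_mono_ennreal:
  fixes h :: "real \<Rightarrow> ennreal"
  assumes "mono h"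
  shows "h \<in> borel_measurable borel"
proof (rule borel_measurableI_greater)
  fix y
  have "is_interval {x. y < h x}"
    unfolding is_interval_1 using assms by (auto simp: mono_def intro: less_le_trans)
  then show "{x \<in> space borel. y < h x} \<in> sets borel"
    using real_interval_borel_measurable by simp
qed

lemma borel_measurable_antimono_ennreal:
  fixes h :: "real \<Rightarrow> ennreal"
  assumes "antimono h"
  shows "h \<in> borel_measurable borel"
proof (rule borel_measurableI_greater)
  fix y
  have "is_interval {x. y < h x}"
    unfolding is_interval_1 using assms by (auto simp: antimono_def intro: less_le_trans)
  then show "{x \<in> space borel. y < h x} \<in> sets borel"
    using real_interval_borel_measurable by simp
qed

text \<open>The fundamental theorem yields a gauge integral; since \<open>g\<close> is nonnegative,
  this is also the Lebesgue integral.\<close>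

lemma nn_integral_Icc_FTC:
  fixes F g :: "real \<Rightarrow> real"
  assumes "a \<le> b" and "continuous_on {a..b} F"
    and "\<And>x. x \<in> {a<..<b} \<Longrightarrow> (F has_real_derivative g x) (at x)"
    and "\<And>x. x \<in> {a..b} \<Longrightarrow> 0 \<le> g x"
  shows "(\<integral>\<^sup>+x\<in>{a..b}. ennreal (g x) \<partial>lborel) = ennreal (F b - F a)"
proof -
  have "(g has_integral (F b - F a)) {a..b}"
    using assms by (intro fundamental_theorem_of_calculus_interior)
      (auto simp: has_real_derivative_iff_has_vector_derivative)
  then have "(\<integral>\<^sup>+x. indicator {a..b} x * g x \<partial>lborel) = ennreal (F b - F a)"
    using assms by (intro nn_integral_has_integral_lebesgue) auto
  moreover have "ennreal (indicator {a..b} x * g x) = ennreal (g x) * indicator {a..b} x" for x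
    by (simp add: indicator_def)
  ultimately show ?thesis
    by simp
qed

lemma norm_integral_le_nn_integral:
  fixes g :: "real \<Rightarrow> complex"
  assumes "continuous_on {a..b} g"
  shows "ennreal (cmod (integral {a..b} g)) \<le> (\<integral>\<^sup>+x\<in>{a..b}. ennreal (cmod (g x)) \<partial>lborel)"
proof -
  have i: "(\<lambda>x. cmod (g x)) integrable_on {a..b}"
    using assms by (intro integrable_continuous_real continuous_intros)
  then have "(\<integral>\<^sup>+x. indicator {a..b} x * cmod (g x) \<partial>lborel) = ennreal (integral {a..b} (\<lambda>x. cmod (g x)))"
    by (intro nn_integral_has_integral_lebesgue) (auto simp: integrable_integral)
  moreover have "ennreal (indicator {a..b} x * cmod (g x)) = ennreal (cmod (g x)) * indicator {a..b} x" for x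
    by (simp add: indicator_def)
  moreover have "cmod (integral {a..b} g) \<le> integral {a..b} (\<lambda>x. cmod (g x))"
    using integrable_continuous_real[OF assms] i by (intro integral_norm_bound_integral) auto
  ultimately show ?thesis
    by (simp add: ennreal_leI)
qed

text \<open>
  For \<open>n > 0\<close> the integrand is at most \<open>(ln (1 / x) + n) ^ (n - 1) * ln (1 / x)\<close>, the derivative of
  \<open>x * (ln (1 / x) + n) ^ n\<close>.
\<close>
lemma nn_integral_ln_power_le:
  fixes t :: real
  assumes "0 < t" "t \<le> 1"
  shows "(\<integral>\<^sup>+x\<in>{0<..t}. ennreal (ln (1 / x) ^ n) \<partial>lborel) \<le> ennreal (t * (ln (1 / t) + n) ^ n)"
proof -
  \<comment> \<open>The logarithm is singular at 0, so the fundamental theorem is applied on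
    \<open>{\<epsilon> k..t}\<close> and monotone convergence gives the whole interval.\<close>
  define \<epsilon> where "\<epsilon> = (\<lambda>k. t / real (Suc k))"
  have \<epsilon>: "0 < \<epsilon> k" "\<epsilon> k \<le> t" for k
    using assms by (auto simp: \<epsilon>_def field_simps)
  let ?G = "\<lambda>x. x * (ln (1 / x) + n) ^ n"
  \<comment> \<open>For \<open>n = 0\<close> the derivative of \<open>?G\<close> is 1. The general
    formula would give \<open>ln (1 / x)\<close> there, because \<open>n - 1\<close> truncates to
    0.\<close>
  let ?g = "\<lambda>x. if n = 0 then 1 else (ln (1 / x) + n) ^ (n - 1) * ln (1 / x)"
  have le: "(\<integral>\<^sup>+x\<in>{\<epsilon> k..t}. ennreal (ln (1 / x) ^ n) \<partial>lborel) \<le> ennreal (?G t)" for k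
  proof -
    have "(\<integral>\<^sup>+x\<in>{\<epsilon> k..t}. ennreal (ln (1 / x) ^ n) \<partial>lborel) \<le> (\<integral>\<^sup>+x\<in>{\<epsilon> k..t}. ennreal (?g x) \<partial>lborel)"
    proof (rule nn_integral_mono)
      fix x
      show "ennreal (ln (1 / x) ^ n) * indicator {\<epsilon> k..t} x \<le> ennreal (?g x) * indicator {\<epsilon> k..t} x"
      proof (cases "x \<in> {\<epsilon> k..t}")
        case True
        then have x: "0 < x" "x \<le> 1"
          using \<epsilon>[of k] assms by auto
        then have L: "0 \<le> ln (1 / x)"
          by simp
        have "ln (1 / x) ^ n \<le> ?g x"
        proof (cases n)
          case (Suc m)
          have "ln (1 / x) ^ m \<le> (ln (1 / x) + n) ^ m"
            using L by (intro power_mono) auto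
          then have "ln (1 / x) ^ m * ln (1 / x) \<le> (ln (1 / x) + n) ^ m * ln (1 / x)"
            using L by (rule mult_right_mono)
          then show ?thesis
            using Suc by (simp add: mult.commute)
        qed auto
        then show ?thesis
          by (intro mult_right_mono ennreal_leI) auto
      qed auto
    qed
    also have "\<dots> = ennreal (?G t - ?G (\<epsilon> k))"
    proof (rule nn_integral_Icc_FTC)
      show "continuous_on {\<epsilon> k..t} ?G"
        using \<epsilon>[of k] by (intro continuous_intros) auto
      show "(?G has_real_derivative ?g x) (at x)" if "x \<in> {\<epsilon> k<..<t}" for x
      proof -
        have x: "0 < x"
          using that \<epsilon>[of k] by auto
        show ?thesis
        proof (cases n)
          case (Suc m)
          \<comment> \<open>The derivative is computed with \<open>- ln x\<close>, which equals
            \<open>ln (1 / x)\<close> on the positive half-line; the two are exchanged at the end on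
            this open set.\<close>
          have "((\<lambda>x. - ln x + n) has_real_derivative - (1 / x)) (at x)"
            using x by (auto intro!: derivative_eq_intros)
          from DERIV_mult[OF DERIV_ident DERIV_power_Suc[OF this, of m]]
          have "((\<lambda>x. x * (- ln x + n) ^ n) has_real_derivative
              1 * (- ln x + n) ^ n + (1 + of_nat m) * (- (1 / x) * (- ln x + n) ^ m) * x) (at x)"
            unfolding Suc .
          also have "1 * (- ln x + n) ^ n + (1 + of_nat m) * (- (1 / x) * (- ln x + n) ^ m) * x = ?g x"
            using x Suc by (simp add: ln_div algebra_simps add_divide_distrib)
          finally have d: "((\<lambda>x. x * (- ln x + n) ^ n) has_real_derivative ?g x) (at x)" .
          show ?thesis
            by (rule has_field_derivative_transform_within_open[OF d, of "{0<..}"]) (use x in \<open>auto simp: ln_div\<close>)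
        qed auto
      qed
      show "0 \<le> ?g x" if "x \<in> {\<epsilon> k..t}" for x
        using that \<epsilon>[of k] assms by (auto intro!: mult_nonneg_nonneg zero_le_power add_nonneg_nonneg)
    qed (use \<epsilon> in auto)
    also have "\<dots> \<le> ennreal (?G t)"
      using \<epsilon>[of k] assms by (intro ennreal_leI) (auto intro!: mult_nonneg_nonneg zero_le_power add_nonneg_nonneg)
    finally show ?thesis .
  qed
  have "(\<integral>\<^sup>+x\<in>{0<..t}. ennreal (ln (1 / x) ^ n) \<partial>lborel)
      \<le> (\<integral>\<^sup>+x. (SUP k. ennreal (ln (1 / x) ^ n) * indicator {\<epsilon> k..t} x) \<partial>lborel)"
  proof (rule nn_integral_mono)
    fix x
    show "ennreal (ln (1 / x) ^ n) * indicator {0<..t} x \<le> (SUP k. ennreal (ln (1 / x) ^ n) * indicator {\<epsilon> k..t} x)"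
    proof (cases "x \<in> {0<..t}")
      case True
      then obtain k where "t / x < real k"
        using reals_Archimedean2 by blast
      then have "x \<in> {\<epsilon> k..t}"
        using True by (auto simp: \<epsilon>_def field_simps)
      then show ?thesis
        using True by (intro SUP_upper2[of k]) auto
    qed auto
  qed
  also have "\<dots> = (SUP k. \<integral>\<^sup>+x\<in>{\<epsilon> k..t}. ennreal (ln (1 / x) ^ n) \<partial>lborel)"
  proof (rule nn_integral_monotone_convergence_SUP)
    have "indicator {\<epsilon> j..t} x \<le> (indicator {\<epsilon> k..t} x :: ennreal)" if "j \<le> k" for j k x
    proof -
      have "\<epsilon> k \<le> \<epsilon> j"
        unfolding \<epsilon>_def using assms that by (intro divide_left_mono) auto
      then show ?thesis
        by (simp add: indicator_def)
    qed
    then show "incseq (\<lambda>k x. ennreal (ln (1 / x) ^ n) * indicator {\<epsilon> k..t} x)"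
      unfolding incseq_def le_fun_def by (simp add: mult_left_mono)
  qed auto
  also have "\<dots> \<le> ennreal (?G t)"
    using le by (rule SUP_least)
  finally show ?thesis .
qed

lemma nn_integral_inverse_square_le:
  fixes t b :: real
  assumes "0 < t"
  shows "(\<integral>\<^sup>+x\<in>{t..b}. ennreal (1 / x\<^sup>2) \<partial>lborel) \<le> ennreal (1 / t)"
proof (cases "t \<le> b")
  case True
  have "(\<integral>\<^sup>+x\<in>{t..b}. ennreal (1 / x\<^sup>2) \<partial>lborel) = ennreal (- 1 / b - - 1 / t)"
    using assms True
    by (intro nn_integral_Icc_FTC)
       (auto intro!: continuous_intros derivative_eq_intros simp: power2_eq_square)
  also have "\<dots> \<le> ennreal (1 / t)"
    using assms True by (intro ennreal_leI) auto
  finally show ?thesis .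
qed auto

lemma nn_integral_inverse:
  fixes t b :: real
  assumes "0 < t" "t \<le> b"
  shows "(\<integral>\<^sup>+x\<in>{t..b}. ennreal (1 / x) \<partial>lborel) = ennreal (ln (b / t))"
proof -
  have "(\<integral>\<^sup>+x\<in>{t..b}. ennreal (1 / x) \<partial>lborel) = ennreal (ln b - ln t)"
    using assms
    by (intro nn_integral_Icc_FTC) (auto intro!: continuous_intros derivative_eq_intros)
  then show ?thesis
    using assms by (simp add: ln_div)
qed

section \<open>From a majorant of the derivative to the boundary\<close>

lemma norm_diff_le_nn_integral:
  fixes \<gamma> :: "real \<Rightarrow> complex"
  assumes "a \<le> b" and "\<And>t. t \<in> {a..b} \<Longrightarrow> (\<gamma> has_vector_derivative \<gamma>' t) (at t)"
    and "continuous_on {a..b} \<gamma>'"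
  shows "ennreal (cmod (\<gamma> b - \<gamma> a)) \<le> (\<integral>\<^sup>+t\<in>{a..b}. ennreal (cmod (\<gamma>' t)) \<partial>lborel)"
proof -
  have "(\<gamma>' has_integral \<gamma> b - \<gamma> a) {a..b}"
    using assms by (intro fundamental_theorem_of_calculus) (auto intro: has_vector_derivative_at_within)
  then show ?thesis
    using norm_integral_le_nn_integral[OF assms(3)] by (simp add: integral_unique)
qed

lemma nn_integral_Icc_eq_Ioc:
  fixes h :: "real \<Rightarrow> ennreal"
  shows "(\<integral>\<^sup>+x\<in>{a..b}. h x \<partial>lborel) = (\<integral>\<^sup>+x\<in>{a<..b}. h x \<partial>lborel)"
  using AE_lborel_singleton[of a]
  by (intro nn_integral_cong_AE, eventually_elim) (auto simp: indicator_def)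

lemma nn_integral_set_mono:
  fixes h k :: "real \<Rightarrow> ennreal"
  assumes "A \<subseteq> B" and "\<And>x. x \<in> A \<Longrightarrow> h x \<le> k x"
  shows "(\<integral>\<^sup>+x\<in>A. h x \<partial>lborel) \<le> (\<integral>\<^sup>+x\<in>B. k x \<partial>lborel)"
  using assms by (intro nn_integral_mono) (auto simp: indicator_def)

section \<open>Elementary properties of the modulus of continuity\<close>

lemma mono_modulus_of_continuity: "mono (modulus_of_continuity g)"
  unfolding modulus_of_continuity_def by (intro monoI SUP_subset_mono) auto

lemma modulus_of_continuity_ge:
  assumes "\<bar>\<theta> - \<phi>\<bar> \<le> \<delta>"
  shows "ennreal (cmod (g (cis \<theta>) - g (cis \<phi>))) \<le> modulus_of_continuity g \<delta>"
  unfolding modulus_of_continuity_def using assms by (intro SUP_upper2[of "(\<theta>, \<phi>)"]) auto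

lemma modulus_of_continuity_le:
  assumes "\<And>\<theta> \<phi>. \<bar>\<theta> - \<phi>\<bar> \<le> \<delta> \<Longrightarrow> ennreal (cmod (g (cis \<theta>) - g (cis \<phi>))) \<le> C"
  shows "modulus_of_continuity g \<delta> \<le> C"
  unfolding modulus_of_continuity_def using assms by (intro SUP_least) auto

lemma modulus_of_continuity_bounded:
  assumes "\<And>z. cmod z = 1 \<Longrightarrow> cmod (g z) \<le> B"
  shows "modulus_of_continuity g \<delta> \<le> ennreal (2 * B)"
proof (rule modulus_of_continuity_le)
  fix \<theta> \<phi>
  have "cmod (g (cis \<theta>) - g (cis \<phi>)) \<le> cmod (g (cis \<theta>)) + cmod (g (cis \<phi>))"
    by (rule norm_triangle_ineq4)
  also have "\<dots> \<le> 2 * B"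
    using assms[of "cis \<theta>"] assms[of "cis \<phi>"] by simp
  finally show "ennreal (cmod (g (cis \<theta>) - g (cis \<phi>))) \<le> ennreal (2 * B)"
    by (rule ennreal_leI)
qed

lemma continuous_extension_bounded:
  assumes "continuous_extension_to_closed_disc f F"
  obtains B where "0 \<le> B" "\<And>z. cmod z = 1 \<Longrightarrow> cmod (F z) \<le> B"
proof -
  have "bounded (F ` cball 0 1)"
    using assms unfolding continuous_extension_to_closed_disc_def
    by (intro compact_imp_bounded compact_continuous_image) auto
  then obtain B where "\<And>z. z \<in> cball 0 1 \<Longrightarrow> cmod (F z) \<le> B"
    unfolding bounded_iff by blast
  then have B: "\<And>z. cmod z = 1 \<Longrightarrow> cmod (F z) \<le> B"
    by simp
  moreover have "0 \<le> B"
    using B[of 1] norm_ge_zero[of "F 1"] by (metis norm_one order_trans)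
  ultimately show ?thesis
    using that by blast
qed

section \<open>Oscillation of f along radii and arcs\<close>

lemma log_Dini_majorant_deriv_le:
  assumes "log_Dini_majorant f r0 \<Phi>" "0 < x" "x < r0"
  shows "ennreal (cmod (deriv f (of_real (1 - x) * cis \<theta>))) \<le> \<Phi> x"
proof -
  have "1 - x \<in> {1 - r0<..<1}"
    using assms by auto
  then have "ennreal (cmod (deriv f (of_real (1 - x) * cis \<theta>))) \<le> \<Phi> (1 - (1 - x))"
    using assms(1) unfolding log_Dini_majorant_def by blast
  then show ?thesis
    by simp
qed

text \<open>The radius is parametrised at unit speed by the distance \<open>x\<close> to the circle,
  which is exactly the argument at which \<open>\<Phi>\<close> bounds the derivative.\<close>

lemma radial_oscillation_le:
  assumes hol: "f holomorphic_on ball 0 1" and maj: "log_Dini_majorant f r0 \<Phi>"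
    and ab: "0 < a" "a \<le> b" "b < r0"
  shows "ennreal (cmod (f (of_real (1 - b) * cis \<theta>) - f (of_real (1 - a) * cis \<theta>)))
           \<le> (\<integral>\<^sup>+x\<in>{a..b}. \<Phi> x \<partial>lborel)"
proof -
  have r0: "r0 < 1"
    using maj by (simp add: log_Dini_majorant_def)
  have ball: "of_real (1 - x) * cis \<theta> \<in> ball 0 1" if "x \<in> {a..b}" for x
    using that ab r0 by (simp add: norm_mult del: of_real_diff)
  have "ennreal (cmod (f (of_real (1 - b) * cis \<theta>) - f (of_real (1 - a) * cis \<theta>)))
          \<le> (\<integral>\<^sup>+x\<in>{a..b}. ennreal (cmod (- cis \<theta> * deriv f (of_real (1 - x) * cis \<theta>))) \<partial>lborel)"
  proof (rule norm_diff_le_nn_integral)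
    show "((\<lambda>x. f (of_real (1 - x) * cis \<theta>)) has_vector_derivative
              - cis \<theta> * deriv f (of_real (1 - x) * cis \<theta>)) (at x)" if "x \<in> {a..b}" for x
    proof -
      have "((\<lambda>x. of_real (1 - x) * cis \<theta>) has_vector_derivative - cis \<theta>) (at x)"
        by (auto intro!: derivative_eq_intros simp: has_vector_derivative_def scaleR_conv_of_real)
      moreover have "(f has_field_derivative deriv f (of_real (1 - x) * cis \<theta>)) (at (of_real (1 - x) * cis \<theta>))"
        using ball[OF that] hol by (intro holomorphic_derivI[of f "ball 0 1"]) auto
      ultimately show ?thesis
        by (rule field_vector_diff_chain_at[unfolded o_def])
    qed
    have cd: "continuous_on (ball 0 1) (deriv f)"
      by (rule holomorphic_on_imp_continuous_on[OF holomorphic_deriv[OF hol open_ball]])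
    have "(\<lambda>x. of_real (1 - x) * cis \<theta>) ` {a..b} \<subseteq> ball 0 1"
      using ball by blast
    then have "continuous_on {a..b} (\<lambda>x. deriv f (of_real (1 - x) * cis \<theta>))"
      by (intro continuous_on_compose2[OF cd] continuous_intros)
    then show "continuous_on {a..b} (\<lambda>x. - cis \<theta> * deriv f (of_real (1 - x) * cis \<theta>))"
      by (intro continuous_on_mult continuous_on_const)
  qed (use ab in auto)
  also have "\<dots> \<le> (\<integral>\<^sup>+x\<in>{a..b}. \<Phi> x \<partial>lborel)"
    using log_Dini_majorant_deriv_le[OF maj] ab
    by (intro nn_integral_set_mono) (auto simp: norm_mult simp del: of_real_diff)
  finally show ?thesis .
qed

text \<open>On the circle of radius \<open>1 - \<delta>\<close> the derivative is bounded by the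
  constant \<open>\<Phi> \<delta>\<close>, and the arc is no longer than
  \<open>\<delta>\<close>.\<close>

lemma circular_oscillation_le:
  assumes hol: "f holomorphic_on ball 0 1" and maj: "log_Dini_majorant f r0 \<Phi>"
    and \<delta>: "0 < \<delta>" "\<delta> < r0" and le: "\<theta> \<le> \<phi>" "\<phi> - \<theta> \<le> \<delta>"
  shows "ennreal (cmod (f (of_real (1 - \<delta>) * cis \<phi>) - f (of_real (1 - \<delta>) * cis \<theta>)))
           \<le> (\<integral>\<^sup>+x\<in>{0..\<delta>}. \<Phi> x \<partial>lborel)"
proof -
  have r0: "r0 < 1"
    using maj by (simp add: log_Dini_majorant_def)
  have ball: "of_real (1 - \<delta>) * cis t \<in> ball 0 1" for t
    using \<delta> r0 by (simp add: norm_mult del: of_real_diff)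
  let ?g = "\<lambda>t. of_real (1 - \<delta>) * (\<i> * cis t) * deriv f (of_real (1 - \<delta>) * cis t)"
  have "ennreal (cmod (f (of_real (1 - \<delta>) * cis \<phi>) - f (of_real (1 - \<delta>) * cis \<theta>)))
          \<le> (\<integral>\<^sup>+t\<in>{\<theta>..\<phi>}. ennreal (cmod (?g t)) \<partial>lborel)"
  proof (rule norm_diff_le_nn_integral)
    show "((\<lambda>t. f (of_real (1 - \<delta>) * cis t)) has_vector_derivative ?g t) (at t)" for t
    proof -
      have "((\<lambda>t. of_real (1 - \<delta>) * cis t) has_vector_derivative of_real (1 - \<delta>) * (\<i> * cis t)) (at t)"
        unfolding cis_conv_exp scaleR_conv_of_real
        by (auto intro!: derivative_eq_intros has_vector_derivative_real_field)
      moreover have "(f has_field_derivative deriv f (of_real (1 - \<delta>) * cis t)) (at (of_real (1 - \<delta>) * cis t))"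
        using ball hol by (intro holomorphic_derivI[of f "ball 0 1"]) auto
      ultimately show ?thesis
        by (rule field_vector_diff_chain_at[unfolded o_def])
    qed
    have cd: "continuous_on (ball 0 1) (deriv f)"
      by (rule holomorphic_on_imp_continuous_on[OF holomorphic_deriv[OF hol open_ball]])
    have "(\<lambda>t. of_real (1 - \<delta>) * cis t) ` {\<theta>..\<phi>} \<subseteq> ball 0 1"
      using ball by blast
    then have "continuous_on {\<theta>..\<phi>} (\<lambda>t. deriv f (of_real (1 - \<delta>) * cis t))"
      by (intro continuous_on_compose2[OF cd] continuous_intros)
    moreover have "continuous_on {\<theta>..\<phi>} (\<lambda>t. of_real (1 - \<delta>) * (\<i> * cis t))"
      by (intro continuous_intros)
    ultimately show "continuous_on {\<theta>..\<phi>} ?g"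
      by (rule continuous_on_mult[rotated])
  qed (use le in auto)
  also have "\<dots> \<le> (\<integral>\<^sup>+t\<in>{\<theta>..\<phi>}. \<Phi> \<delta> \<partial>lborel)"
  proof (rule nn_integral_set_mono)
    fix t
    \<comment> \<open>The speed \<open>1 - \<delta>\<close> of the arc is estimated by 1.\<close>
    have "cmod (?g t) \<le> cmod (deriv f (of_real (1 - \<delta>) * cis t))"
      using \<delta> r0 by (simp add: norm_mult mult_left_le_one_le del: of_real_diff)
    then show "ennreal (cmod (?g t)) \<le> \<Phi> \<delta>"
      using log_Dini_majorant_deriv_le[OF maj \<delta>, of t] by (meson ennreal_leI order_trans)
  qed auto
  also have "\<dots> = \<Phi> \<delta> * ennreal (\<phi> - \<theta>)"
    using le by (simp add: nn_integral_cmult_indicator)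
  also have "\<dots> \<le> \<Phi> \<delta> * ennreal \<delta>"
    using le by (intro mult_left_mono ennreal_leI) auto
  also have "\<dots> = (\<integral>\<^sup>+x\<in>{0..\<delta>}. \<Phi> \<delta> \<partial>lborel)"
    using \<delta> by (simp add: nn_integral_cmult_indicator)
  \<comment> \<open>Monotonicity enters here: \<open>\<Phi> \<delta>\<close> is the smallest value
    of \<open>\<Phi>\<close> on \<open>{0..\<delta>}\<close>.\<close>
  also have "\<dots> \<le> (\<integral>\<^sup>+x\<in>{0..\<delta>}. \<Phi> x \<partial>lborel)"
    using maj \<delta> by (intro nn_integral_set_mono) (auto simp: log_Dini_majorant_def monotone_on_def)
  finally show ?thesis .
qed

text \<open>The radial estimate applies only inside the disc. Its right-hand side is bounded
  independently of the inner endpoint \<open>a\<close>, so \<open>a\<close> can tend to 0 from the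
  right by continuity of \<open>F\<close>.\<close>

lemma boundary_oscillation_le:
  assumes hol: "f holomorphic_on ball 0 1" and maj: "log_Dini_majorant f r0 \<Phi>"
    and ext: "continuous_extension_to_closed_disc f F" and \<delta>: "0 < \<delta>" "\<delta> < r0"
  shows "ennreal (cmod (f (of_real (1 - \<delta>) * cis \<theta>) - F (cis \<theta>))) \<le> (\<integral>\<^sup>+x\<in>{0..\<delta>}. \<Phi> x \<partial>lborel)"
proof (rule tendsto_upperbound)
  have r0: "r0 < 1"
    using maj by (simp add: log_Dini_majorant_def)
  let ?F = "\<lambda>a. F (of_real (1 - a) * cis \<theta>)"
  have cont: "continuous_on (cball 0 1) F" and Ff: "\<And>z. z \<in> ball 0 1 \<Longrightarrow> F z = f z"
    using ext by (auto simp: continuous_extension_to_closed_disc_def)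
  have "continuous_on {0..1} ?F"
    by (intro continuous_on_compose2[OF cont] continuous_intros) (auto simp: norm_mult simp del: of_real_diff)
  then have "(?F \<longlongrightarrow> ?F 0) (at 0 within {0..1})"
    unfolding continuous_on by (rule bspec) simp
  then have "(?F \<longlongrightarrow> F (cis \<theta>)) (at_right 0)"
    by (simp add: at_within_Icc_at_right)
  then show "((\<lambda>a. ennreal (cmod (f (of_real (1 - \<delta>) * cis \<theta>) - ?F a)))
      \<longlongrightarrow> ennreal (cmod (f (of_real (1 - \<delta>) * cis \<theta>) - F (cis \<theta>)))) (at_right 0)"
    by (intro tendsto_intros)
  have "ennreal (cmod (f (of_real (1 - \<delta>) * cis \<theta>) - ?F a)) \<le> (\<integral>\<^sup>+x\<in>{0..\<delta>}. \<Phi> x \<partial>lborel)"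
    if "a \<in> {0<..<\<delta>}" for a
  proof -
    have "?F a = f (of_real (1 - a) * cis \<theta>)"
      using that \<delta> r0 by (intro Ff) (simp add: norm_mult del: of_real_diff)
    also have "ennreal (cmod (f (of_real (1 - \<delta>) * cis \<theta>) - \<dots>)) \<le> (\<integral>\<^sup>+x\<in>{a..\<delta>}. \<Phi> x \<partial>lborel)"
      using that \<delta> by (intro radial_oscillation_le[OF hol maj]) auto
    also have "\<dots> \<le> (\<integral>\<^sup>+x\<in>{0..\<delta>}. \<Phi> x \<partial>lborel)"
      using that by (intro nn_integral_set_mono) auto
    finally show ?thesis .
  qed
  then show "\<forall>\<^sub>F a in at_right 0. ennreal (cmod (f (of_real (1 - \<delta>) * cis \<theta>) - ?F a))
      \<le> (\<integral>\<^sup>+x\<in>{0..\<delta>}. \<Phi> x \<partial>lborel)"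
    using \<delta>(1) by (rule eventually_at_rightI)
qed auto

text \<open>The factor 3 counts the pieces of the path from one boundary point to the other: a
  radial segment inwards, an arc, and a radial segment outwards.\<close>

lemma modulus_of_continuity_le_majorant:
  assumes hol: "f holomorphic_on ball 0 1" and maj: "log_Dini_majorant f r0 \<Phi>"
    and ext: "continuous_extension_to_closed_disc f F" and \<delta>: "0 \<le> \<delta>" "\<delta> < r0"
  shows "modulus_of_continuity F \<delta> \<le> 3 * (\<integral>\<^sup>+x\<in>{0..\<delta>}. \<Phi> x \<partial>lborel)"
proof (rule modulus_of_continuity_le)
  fix \<theta> \<phi> :: real
  assume le: "\<bar>\<theta> - \<phi>\<bar> \<le> \<delta>"
  let ?I = "\<integral>\<^sup>+x\<in>{0..\<delta>}. \<Phi> x \<partial>lborel"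
  show "ennreal (cmod (F (cis \<theta>) - F (cis \<phi>))) \<le> 3 * ?I"
  \<comment> \<open>For \<open>\<delta> = 0\<close> the arc would lie on the boundary itself, but
    then the two angles coincide and the left side vanishes.\<close>
  proof (cases "\<delta> = 0")
    case True
    then show ?thesis
      using le by simp
  next
    case False
    then have \<delta>0: "0 < \<delta>"
      using \<delta> by simp
    let ?z = "\<lambda>t. f (of_real (1 - \<delta>) * cis t)"
    have arc: "ennreal (cmod (?z \<theta> - ?z \<phi>)) \<le> ?I"
    proof (cases "\<theta> \<le> \<phi>")
      case True
      then show ?thesis
        using circular_oscillation_le[OF hol maj \<delta>0 \<delta>(2) True] le by (simp add: norm_minus_commute)
    next
      case False
      then show ?thesis
        using circular_oscillation_le[OF hol maj \<delta>0 \<delta>(2), of \<phi> \<theta>] le by simp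
    qed
    have "cmod (F (cis \<theta>) - F (cis \<phi>))
        = cmod ((?z \<theta> - ?z \<phi>) - (?z \<theta> - F (cis \<theta>)) + (?z \<phi> - F (cis \<phi>)))"
      by simp
    also have "\<dots> \<le> cmod (?z \<theta> - ?z \<phi>) + cmod (?z \<theta> - F (cis \<theta>)) + cmod (?z \<phi> - F (cis \<phi>))"
      by (meson add_mono norm_triangle_ineq norm_triangle_ineq4 order_refl order_trans)
    finally have "ennreal (cmod (F (cis \<theta>) - F (cis \<phi>)))
        \<le> ennreal (cmod (?z \<theta> - ?z \<phi>)) + ennreal (cmod (?z \<theta> - F (cis \<theta>))) + ennreal (cmod (?z \<phi> - F (cis \<phi>)))"
      by (simp flip: ennreal_plus)
    also have "\<dots> \<le> ?I + ?I + ?I"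
      by (intro add_mono arc boundary_oscillation_le[OF hol maj ext \<delta>0 \<delta>(2)])
    also have "\<dots> = (1 + 1 + 1) * ?I"
      by (simp only: distrib_right mult_1)
    also have "(1 + 1 + 1 :: ennreal) = 3"
      by simp
    finally show ?thesis .
  qed
qed

section \<open>Weighted integrability of the majorant and the continuous extension\<close>

text \<open>Nothing is known about \<open>\<Phi>\<close> outside \<open>{0..<r0}\<close>. Continuing
  it by infinity on the left and by 0 on the right keeps it nonincreasing on the whole line, hence
  Borel measurable.\<close>

lemma log_Dini_majorant_truncation:
  assumes "log_Dini_majorant f r0 \<Phi>"
  obtains \<Psi> where "\<Psi> \<in> borel_measurable borel" "\<And>x. x \<in> {0..<r0} \<Longrightarrow> \<Psi> x = \<Phi> x"
    "\<And>n. (\<integral>\<^sup>+x\<in>{0<..<r0}. ennreal (ln (1 / x) ^ n) * \<Psi> x \<partial>lborel) < \<infinity>"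
proof -
  define \<Psi> where "\<Psi> = (\<lambda>x. if x < 0 then \<infinity> else if x < r0 then \<Phi> x else 0)"
  have anti: "antimono_on {0..<r0} \<Phi>"
    and int: "\<And>n. (\<integral>\<^sup>+x. ennreal (ln (1 / x) ^ n) * \<Phi> x \<partial>lebesgue_on {0..<r0}) < \<infinity>"
    using assms by (auto simp: log_Dini_majorant_def L1_on_def)
  have "antimono \<Psi>"
    using anti by (auto simp: \<Psi>_def antimono_def monotone_on_def)
  then have "\<Psi> \<in> borel_measurable borel"
    by (rule borel_measurable_antimono_ennreal)
  moreover have eq: "\<Psi> x = \<Phi> x" if "x \<in> {0..<r0}" for x
    using that by (simp add: \<Psi>_def)
  moreover have "(\<integral>\<^sup>+x\<in>{0<..<r0}. ennreal (ln (1 / x) ^ n) * \<Psi> x \<partial>lborel) < \<infinity>" for n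
  proof -
    have "(\<integral>\<^sup>+x\<in>{0<..<r0}. ennreal (ln (1 / x) ^ n) * \<Psi> x \<partial>lborel)
        \<le> (\<integral>\<^sup>+x\<in>{0..<r0}. ennreal (ln (1 / x) ^ n) * \<Phi> x \<partial>lborel)"
      by (rule nn_integral_set_mono) (auto simp: eq)
    also have "\<dots> < \<infinity>"
      using int[of n] by (simp add: nn_integral_lebesgue_on)
    finally show ?thesis .
  qed
  ultimately show ?thesis
    using that by blast
qed

text \<open>
  The logarithmic weight, at least \<open>ln (1 / b)\<close> on \<open>{a..b}\<close>, turns integrability into an explicit
  modulus of convergence along the radii.
\<close>
lemma radial_oscillation_uniform:
  assumes hol: "f holomorphic_on ball 0 1" and maj: "log_Dini_majorant f r0 \<Phi>"
  obtains A where "0 \<le> A" "\<And>a b \<theta>. 0 < a \<Longrightarrow> a \<le> b \<Longrightarrow> b < r0 \<Longrightarrow>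
     cmod (f (of_real (1 - b) * cis \<theta>) - f (of_real (1 - a) * cis \<theta>)) \<le> A / ln (1 / b)"
proof -
  obtain \<Psi> where \<Psi>[measurable]: "\<Psi> \<in> borel_measurable borel" and eq: "\<And>x. x \<in> {0..<r0} \<Longrightarrow> \<Psi> x = \<Phi> x"
    and int: "\<And>n. (\<integral>\<^sup>+x\<in>{0<..<r0}. ennreal (ln (1 / x) ^ n) * \<Psi> x \<partial>lborel) < \<infinity>"
    using log_Dini_majorant_truncation[OF maj] by blast
  have r0: "r0 < 1"
    using maj by (simp add: log_Dini_majorant_def)
  \<comment> \<open>The integrability condition with exponent 1 makes this finite.\<close>
  let ?J = "\<integral>\<^sup>+x\<in>{0<..<r0}. ennreal (ln (1 / x)) * \<Psi> x \<partial>lborel"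
  obtain A where A: "0 \<le> A" "?J = ennreal A"
    using int[of 1] by (cases ?J) auto
  show ?thesis
  proof (rule that[OF A(1)])
    fix a b \<theta> :: real
    assume ab: "0 < a" "a \<le> b" "b < r0"
    let ?d = "cmod (f (of_real (1 - b) * cis \<theta>) - f (of_real (1 - a) * cis \<theta>))"
    have L: "0 < ln (1 / b)"
      using ab r0 by simp
    have "ennreal ?d \<le> (\<integral>\<^sup>+x\<in>{a..b}. \<Phi> x \<partial>lborel)"
      using radial_oscillation_le[OF hol maj ab] .
    also have "\<dots> \<le> (\<integral>\<^sup>+x\<in>{a..b}. \<Psi> x \<partial>lborel)"
      using ab by (intro nn_integral_set_mono) (auto simp: eq)
    finally have "ennreal (ln (1 / b)) * ennreal ?d \<le> ennreal (ln (1 / b)) * (\<integral>\<^sup>+x\<in>{a..b}. \<Psi> x \<partial>lborel)"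
      by (intro mult_left_mono) auto
    also have "\<dots> = (\<integral>\<^sup>+x\<in>{a..b}. ennreal (ln (1 / b)) * \<Psi> x \<partial>lborel)"
      by (subst nn_integral_cmult[symmetric]) (auto simp: mult_ac)
    \<comment> \<open>On \<open>{a..b}\<close> the constant \<open>ln (1 / b)\<close> is at most
      \<open>ln (1 / x)\<close>.\<close>
    also have "\<dots> \<le> ?J"
      using ab r0 by (intro nn_integral_set_mono mult_right_mono ennreal_leI) (auto simp: ln_div)
    finally have "ennreal (ln (1 / b) * ?d) \<le> ennreal A"
      using A L by (simp add: ennreal_mult')
    then have "ln (1 / b) * ?d \<le> A"
      using A by simp
    then show "?d \<le> A / ln (1 / b)"
      using L by (simp add: field_simps)
  qed
qed

text \<open>The dilations \<open>g n\<close> of \<open>f\<close> are continuous on the closed disc.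
  The radial estimate, uniform in the angle, makes them uniformly Cauchy on the unit circle, and the
  maximum principle carries this inside. Their uniform limit is the extension.\<close>

lemma continuous_extension_exists:
  assumes hol: "f holomorphic_on ball 0 1" and maj: "log_Dini_majorant f r0 \<Phi>"
  obtains F where "continuous_extension_to_closed_disc f F"
proof -
  obtain A where A: "0 \<le> A" and osc: "\<And>a b \<theta>. 0 < a \<Longrightarrow> a \<le> b \<Longrightarrow> b < r0 \<Longrightarrow>
     cmod (f (of_real (1 - b) * cis \<theta>) - f (of_real (1 - a) * cis \<theta>)) \<le> A / ln (1 / b)"
    using radial_oscillation_uniform[OF hol maj] by blast
  have r0: "0 < r0" "r0 < 1"
    using maj by (auto simp: log_Dini_majorant_def)
  \<comment> \<open>The summand 2 keeps \<open>\<rho> n\<close> strictly below \<open>r0\<close>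
    already for \<open>n = 0\<close>, as the radial estimate requires.\<close>
  define \<rho> where "\<rho> = (\<lambda>n::nat. r0 / (2 + real n))"
  have \<rho>: "0 < \<rho> n" "\<rho> n < r0" "\<rho> n < 1" for n
    using r0 by (auto simp: \<rho>_def field_simps add_pos_nonneg)
  have \<rho>_mono: "\<rho> n \<le> \<rho> m" if "m \<le> n" for m n
    using that r0 by (auto simp: \<rho>_def field_simps)
  have \<rho>_lim: "\<rho> \<longlonglongrightarrow> 0"
    unfolding \<rho>_def by real_asymp
  define g where "g = (\<lambda>n z. f (of_real (1 - \<rho> n) * z))"
  have in_ball: "of_real (1 - \<rho> n) * z \<in> ball 0 1" if "z \<in> cball 0 1" for n and z :: complex
  proof -
    have "(1 - \<rho> n) * cmod z \<le> 1 - \<rho> n"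
      using that \<rho>[of n] by (intro mult_left_le) auto
    also have "\<dots> < 1"
      using \<rho>[of n] by simp
    finally show ?thesis
      using \<rho>[of n] by (simp add: norm_mult del: of_real_diff)
  qed
  have cont_g: "continuous_on (cball 0 1) (g n)" for n
    unfolding g_def using in_ball
    by (intro continuous_on_compose2[OF holomorphic_on_imp_continuous_on[OF hol]] continuous_intros) blast
  have hol_g: "g n holomorphic_on ball 0 1" for n
  proof -
    have "(f \<circ> (\<lambda>z. of_real (1 - \<rho> n) * z)) holomorphic_on ball 0 1"
      using in_ball by (intro holomorphic_on_compose_gen[OF _ hol] holomorphic_intros) auto
    then show ?thesis
      by (simp add: g_def o_def)
  qed
  \<comment> \<open>On the circle this is the radial estimate between the distances
    \<open>\<rho> n\<close> and \<open>\<rho> m\<close>; the maximum modulus principle extends it to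
    the disc.\<close>
  have bd: "cmod (g m z - g n z) \<le> A / ln (1 / \<rho> m)" if "m \<le> n" "z \<in> cball 0 1" for m n z
  proof (rule maximum_modulus_frontier[where f = "\<lambda>z. g m z - g n z" and S = "cball 0 1"])
    show "(\<lambda>z. g m z - g n z) holomorphic_on interior (cball 0 1)"
      using hol_g by (auto intro!: holomorphic_intros)
    show "continuous_on (closure (cball 0 1)) (\<lambda>z. g m z - g n z)"
      using cont_g by (auto intro!: continuous_intros)
    fix \<zeta> :: complex
    assume "\<zeta> \<in> frontier (cball 0 1)"
    then have "\<zeta> = cis (Arg \<zeta>)"
      using rcis_cmod_Arg[of \<zeta>] by (simp add: rcis_def)
    then show "cmod (g m \<zeta> - g n \<zeta>) \<le> A / ln (1 / \<rho> m)"
      unfolding g_def using osc[OF \<rho>(1)[of n] \<rho>_mono[OF that(1)] \<rho>(2)[of m], of "Arg \<zeta>"] by simp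
  qed (use that in auto)
  have lim: "(\<lambda>m. A / ln (1 / \<rho> m)) \<longlonglongrightarrow> 0"
    unfolding \<rho>_def using r0 by real_asymp
  have "uniformly_Cauchy_on (cball 0 1) g"
  proof (rule uniformly_Cauchy_onI')
    fix e :: real
    assume "0 < e"
    then have "\<forall>\<^sub>F m in sequentially. A / ln (1 / \<rho> m) < e"
      by (rule order_tendstoD(2)[OF lim])
    then obtain M where M: "\<And>m. M \<le> m \<Longrightarrow> A / ln (1 / \<rho> m) < e"
      unfolding eventually_sequentially by blast
    have "dist (g m x) (g n x) < e" if "x \<in> cball 0 1" "M \<le> m" "m < n" for x m n
      unfolding dist_norm using bd[of m n x] M[of m] that by linarith
    then show "\<exists>M. \<forall>x\<in>cball 0 1. \<forall>m\<ge>M. \<forall>n>m. dist (g m x) (g n x) < e"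
      by blast
  qed
  then obtain F where F: "uniform_limit (cball 0 1) g F sequentially"
    using Cauchy_uniformly_convergent uniformly_convergent_on_def by blast
  have "continuous_on (cball 0 1) F"
    using cont_g F by (intro uniform_limit_theorem[of _ g]) auto
  moreover have "F z = f z" if z: "z \<in> ball 0 1" for z
  proof -
    have "(\<lambda>n. g n z) \<longlonglongrightarrow> F z"
      using F z by (intro tendsto_uniform_limitI[OF F]) auto
    moreover have "(\<lambda>n. g n z) \<longlonglongrightarrow> f z"
      unfolding g_def
    proof (rule isCont_tendsto_compose[where g = f])
      show "isCont f z"
        using continuous_on_interior[OF holomorphic_on_imp_continuous_on[OF hol]] z by simp
      have "(\<lambda>n. of_real (1 - \<rho> n) * z) \<longlonglongrightarrow> of_real (1 - 0) * z"
        by (intro tendsto_intros \<rho>_lim)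
      then show "(\<lambda>n. of_real (1 - \<rho> n) * z) \<longlonglongrightarrow> z"
        by simp
    qed
    ultimately show ?thesis
      by (rule LIMSEQ_unique)
  qed
  ultimately show ?thesis
    using that unfolding continuous_extension_to_closed_disc_def by blast
qed

section \<open>The log-Dini condition for the boundary function\<close>

text \<open>Tonelli on the region \<open>0 < t \<le> x < b\<close>: for fixed \<open>t\<close> one
  has \<open>ln (1 / x) ^ n \<le> ln (1 / t) ^ n\<close>, and the remaining integral of
  \<open>1 / x\<close> over \<open>{t..1}\<close> is \<open>ln (1 / t)\<close>, the extra
  logarithm.\<close>

lemma nn_integral_ln_power_primitive_le:
  fixes \<Psi> :: "real \<Rightarrow> ennreal"
  assumes [measurable]: "\<Psi> \<in> borel_measurable borel" and b: "b \<le> 1"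
  shows "(\<integral>\<^sup>+x\<in>{0<..<b}. ennreal (ln (1 / x) ^ n / x) * (\<integral>\<^sup>+t\<in>{0<..x}. \<Psi> t \<partial>lborel) \<partial>lborel)
           \<le> (\<integral>\<^sup>+t\<in>{0<..<b}. ennreal (ln (1 / t) ^ Suc n) * \<Psi> t \<partial>lborel)"
proof -
  \<comment> \<open>The region of integration is built into the kernel, so that both iterated
    integrals run over the whole line.\<close>
  define K where "K = (\<lambda>x t. if 0 < t \<and> t \<le> x \<and> x < b then ennreal (ln (1 / x) ^ n / x) * \<Psi> t else 0)"
  have K: "case_prod K \<in> borel_measurable (lborel \<Otimes>\<^sub>M lborel)"
    unfolding K_def by measurable
  have "(\<integral>\<^sup>+x\<in>{0<..<b}. ennreal (ln (1 / x) ^ n / x) * (\<integral>\<^sup>+t\<in>{0<..x}. \<Psi> t \<partial>lborel) \<partial>lborel)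
      = (\<integral>\<^sup>+x. \<integral>\<^sup>+t. K x t \<partial>lborel \<partial>lborel)"
  proof (rule nn_integral_cong)
    fix x
    show "ennreal (ln (1 / x) ^ n / x) * (\<integral>\<^sup>+t\<in>{0<..x}. \<Psi> t \<partial>lborel) * indicator {0<..<b} x
        = (\<integral>\<^sup>+t. K x t \<partial>lborel)"
    proof (cases "x \<in> {0<..<b}")
      case True
      then have "K x t = ennreal (ln (1 / x) ^ n / x) * (\<Psi> t * indicator {0<..x} t)" for t
        by (auto simp: K_def)
      then show ?thesis
        using True by (simp add: nn_integral_cmult)
    next
      case False
      then have "K x t = 0" for t
        by (auto simp: K_def)
      then show ?thesis
        using False by simp
    qed
  qed
  also have "\<dots> = (\<integral>\<^sup>+t. \<integral>\<^sup>+x. K x t \<partial>lborel \<partial>lborel)"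
    by (rule lborel_pair.Fubini'[OF K, symmetric])
  also have "\<dots> \<le> (\<integral>\<^sup>+t\<in>{0<..<b}. ennreal (ln (1 / t) ^ Suc n) * \<Psi> t \<partial>lborel)"
  proof (rule nn_integral_mono)
    fix t
    show "(\<integral>\<^sup>+x. K x t \<partial>lborel) \<le> ennreal (ln (1 / t) ^ Suc n) * \<Psi> t * indicator {0<..<b} t"
    proof (cases "t \<in> {0<..<b}")
      case True
      have "(\<integral>\<^sup>+x. K x t \<partial>lborel)
          \<le> (\<integral>\<^sup>+x. ennreal (ln (1 / t) ^ n) * \<Psi> t * (ennreal (1 / x) * indicator {t..1} x) \<partial>lborel)"
      proof (rule nn_integral_mono)
        fix x
        show "K x t \<le> ennreal (ln (1 / t) ^ n) * \<Psi> t * (ennreal (1 / x) * indicator {t..1} x)"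
        proof (cases "t \<le> x \<and> x < b")
          case x: True
          then have "ln (1 / x) \<le> ln (1 / t)" "0 \<le> ln (1 / x)"
            using True b by (auto simp: ln_div)
          then have "ln (1 / x) ^ n / x \<le> ln (1 / t) ^ n * (1 / x)"
            using True x by (simp add: divide_right_mono power_mono)
          then have "ennreal (ln (1 / x) ^ n / x) \<le> ennreal (ln (1 / t) ^ n) * ennreal (1 / x)"
            using True x b by (subst ennreal_mult[symmetric]) (auto intro!: ennreal_leI)
          then have "ennreal (ln (1 / x) ^ n / x) * \<Psi> t \<le> ennreal (ln (1 / t) ^ n) * ennreal (1 / x) * \<Psi> t"
            by (rule mult_right_mono) simp
          then show ?thesis
            using True x b by (simp add: K_def mult_ac)
        qed (auto simp: K_def)
      qed
      also have "\<dots> = ennreal (ln (1 / t) ^ n) * \<Psi> t * ennreal (ln (1 / t))"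
        using True b by (simp add: nn_integral_cmult nn_integral_inverse)
      also have "\<dots> = ennreal (ln (1 / t) ^ Suc n) * \<Psi> t * indicator {0<..<b} t"
      proof -
        have "ennreal (ln (1 / t) ^ Suc n) = ennreal (ln (1 / t) ^ n) * ennreal (ln (1 / t))"
          using True b by (subst ennreal_mult[symmetric]) (auto simp: mult.commute)
        then show ?thesis
          using True by (simp add: mult_ac)
      qed
      finally show ?thesis .
    next
      case False
      then have "K x t = 0" for x
        by (auto simp: K_def)
      then show ?thesis
        by simp
    qed
  qed
  finally show ?thesis .
qed

text \<open>The integral is split at \<open>r0\<close>. Below it the modulus is at most three times
  the primitive of \<open>\<Phi>\<close>, and the preceding lemma reduces exponent \<open>n\<close>
  to the majorant condition with exponent \<open>Suc n\<close>. Above it the integrand is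
  bounded.\<close>

lemma log_Dini_continuous_if_majorant:
  assumes hol: "f holomorphic_on ball 0 1" and maj: "log_Dini_majorant f r0 \<Phi>"
    and ext: "continuous_extension_to_closed_disc f F"
  shows "log_Dini_continuous F"
  unfolding log_Dini_continuous_def
proof (intro conjI allI)
  show "continuous_on (sphere 0 1) F"
    using ext unfolding continuous_extension_to_closed_disc_def
    by (auto intro: continuous_on_subset)
  fix n
  obtain \<Psi> where \<Psi>[measurable]: "\<Psi> \<in> borel_measurable borel" and eq: "\<And>x. x \<in> {0..<r0} \<Longrightarrow> \<Psi> x = \<Phi> x"
    and int: "\<And>n. (\<integral>\<^sup>+x\<in>{0<..<r0}. ennreal (ln (1 / x) ^ n) * \<Psi> x \<partial>lborel) < \<infinity>"
    using log_Dini_majorant_truncation[OF maj] by blast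
  have r0: "0 < r0" "r0 < 1"
    using maj by (auto simp: log_Dini_majorant_def)
  obtain B where B: "0 \<le> B" "\<And>z. cmod z = 1 \<Longrightarrow> cmod (F z) \<le> B"
    using continuous_extension_bounded[OF ext] by blast
  \<comment> \<open>Bound on \<open>{r0..1}\<close>: the logarithm and \<open>1 / x\<close> are
    largest at \<open>r0\<close>, and the modulus is at most \<open>2 * B\<close>.\<close>
  define c where "c = ln (1 / r0) ^ n * (2 * B / r0)"
  let ?\<omega> = "modulus_of_continuity F"
  let ?P = "\<lambda>x. \<integral>\<^sup>+t\<in>{0<..x}. \<Psi> t \<partial>lborel"
  have "mono ?P"
    by (intro monoI nn_integral_set_mono) auto
  then have [measurable]: "?P \<in> borel_measurable borel"
    by (rule borel_measurable_mono_ennreal)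
  have pt: "ennreal (ln (1 / x) ^ n) * (?\<omega> x / ennreal x) * indicator {0<..<1} x
      \<le> 3 * (ennreal (ln (1 / x) ^ n / x) * ?P x * indicator {0<..<r0} x) + ennreal c * indicator {r0..1} x" for x
  proof (cases "x \<in> {0<..<1}")
    case x: True
    have quot: "ennreal (ln (1 / x) ^ n) * (w / ennreal x) = ennreal (ln (1 / x) ^ n / x) * w" for w
      using x by (simp add: divide_ennreal_conv_mult flip: ennreal_mult mult.assoc)
    show ?thesis
    proof (cases "x < r0")
      case True
      have "?\<omega> x \<le> 3 * (\<integral>\<^sup>+t\<in>{0..x}. \<Phi> t \<partial>lborel)"
        using modulus_of_continuity_le_majorant[OF hol maj ext] True x by auto
      also have "(\<integral>\<^sup>+t\<in>{0..x}. \<Phi> t \<partial>lborel) \<le> ?P x"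
        unfolding nn_integral_Icc_eq_Ioc using True by (intro nn_integral_set_mono) (auto simp: eq)
      finally have "?\<omega> x \<le> 3 * ?P x"
        by (simp add: mult_left_mono)
      then have "ennreal (ln (1 / x) ^ n / x) * ?\<omega> x \<le> ennreal (ln (1 / x) ^ n / x) * (3 * ?P x)"
        by (rule mult_left_mono) simp
      then show ?thesis
        unfolding quot using True x by (simp add: mult_ac)
    next
      case False
      have "ennreal (ln (1 / x) ^ n / x) * ?\<omega> x \<le> ennreal (ln (1 / x) ^ n / x) * ennreal (2 * B)"
        using B by (intro mult_left_mono modulus_of_continuity_bounded) auto
      also have "\<dots> = ennreal (ln (1 / x) ^ n * (2 * B / x))"
        using x B by (subst ennreal_mult[symmetric]) auto
      also have "\<dots> \<le> ennreal c"
        unfolding c_def using x B r0 False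
        by (intro ennreal_leI mult_mono power_mono divide_left_mono) (auto simp: ln_div)
      finally show ?thesis
        unfolding quot using False x by simp
    qed
  qed simp
  have "(\<integral>\<^sup>+x. ennreal (ln (1 / x) ^ n) * (?\<omega> x / ennreal x) \<partial>lebesgue_on {0<..<1})
      \<le> (\<integral>\<^sup>+x. 3 * (ennreal (ln (1 / x) ^ n / x) * ?P x * indicator {0<..<r0} x) + ennreal c * indicator {r0..1} x \<partial>lborel)"
    unfolding nn_integral_lebesgue_on[OF borel_open[OF open_greaterThanLessThan]] by (rule nn_integral_mono) (rule pt)
  also have "\<dots> = 3 * (\<integral>\<^sup>+x\<in>{0<..<r0}. ennreal (ln (1 / x) ^ n / x) * ?P x \<partial>lborel) + ennreal c * emeasure lborel {r0..1}"
    by (simp add: nn_integral_add nn_integral_cmult nn_integral_cmult_indicator)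
  also have "\<dots> \<le> 3 * (\<integral>\<^sup>+t\<in>{0<..<r0}. ennreal (ln (1 / t) ^ Suc n) * \<Psi> t \<partial>lborel) + ennreal c * emeasure lborel {r0..1}"
    using r0 by (intro add_mono mult_left_mono nn_integral_ln_power_primitive_le) auto
  also have "\<dots> < \<infinity>"
    using int[of "Suc n"] r0 by (auto simp: ennreal_mult_less_top)
  finally show "(\<integral>\<^sup>+x. ennreal (ln (1 / x) ^ n) * (?\<omega> x / ennreal x) \<partial>lebesgue_on {0<..<1}) < \<infinity>" .
qed

section \<open>From the boundary modulus to a majorant of the derivative\<close>

text \<open>Jordan's inequality with a crude constant. Up to \<open>pi / 3\<close> the derivative of
  \<open>4 * sin u - u\<close> is at least 1, since the cosine is at least 1/2; beyond that
  \<open>4 * sin y\<close> is at least 2, hence at least \<open>pi / 2\<close>.\<close>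

lemma le_four_sin:
  fixes y :: real
  assumes "0 \<le> y" "y \<le> pi / 2"
  shows "y \<le> 4 * sin y"
proof (cases "y \<le> pi / 3")
  case True
  have "4 * sin 0 - 0 \<le> 4 * sin y - y"
  proof (rule DERIV_nonneg_imp_nondecreasing[where f = "\<lambda>u. 4 * sin u - u"])
    fix u :: real
    assume u: "0 \<le> u" "u \<le> y"
    have "cos (pi / 3) \<le> cos u"
      using u True by (intro cos_monotone_0_pi_le) auto
    then have "0 \<le> 4 * cos u - 1"
      by (simp add: cos_60)
    moreover have "((\<lambda>u. 4 * sin u - u) has_real_derivative 4 * cos u - 1) (at u)"
      by (auto intro!: derivative_eq_intros)
    ultimately show "\<exists>d. ((\<lambda>u. 4 * sin u - u) has_real_derivative d) (at u) \<and> 0 \<le> d"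
      by blast
  qed (use assms in auto)
  then show ?thesis
    by simp
next
  case False
  then have "sin (pi / 6) \<le> sin y"
    using assms pi_gt_zero by (intro sin_monotone_2pi_le) auto
  then show ?thesis
    using assms pi_half_le_two by (simp add: sin_30)
qed

text \<open>The squared distance equals
  \<open>(1 - r)\<^sup>2 + 4 * r * (sin (\<tau> / 2))\<^sup>2\<close>. As \<open>r\<close> is at
  least 1/2, the second term is at least twice the squared sine, and \<open>le_four_sin\<close>
  bounds \<open>\<tau>\<^sup>2\<close> by 64 squared sines; hence the factor 32.\<close>

lemma norm_cis_minus_of_real_ge:
  assumes "1 / 2 \<le> r" "r < 1" "\<bar>\<tau>\<bar> \<le> pi"
  shows "(max (1 - r) \<bar>\<tau>\<bar>)\<^sup>2 \<le> 32 * (cmod (cis \<tau> - of_real r))\<^sup>2"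
proof -
  let ?s = "sin (\<bar>\<tau>\<bar> / 2)"
  have "cos \<tau> = cos (2 * (\<bar>\<tau>\<bar> / 2))"
    by simp
  then have cos: "cos \<tau> = 1 - 2 * ?s\<^sup>2"
    by (simp only: cos_double_sin)
  have "(cmod (cis \<tau> - of_real r))\<^sup>2 = (cos \<tau> - r)\<^sup>2 + (sin \<tau>)\<^sup>2"
    by (simp add: cmod_power2)
  also have "\<dots> = (1 - r)\<^sup>2 + 2 * r * (1 - cos \<tau>)"
    by (simp add: sin_squared_eq power2_eq_square algebra_simps)
  also have "\<dots> = (1 - r)\<^sup>2 + (2 * r) * (2 * ?s\<^sup>2)"
    by (simp add: cos)
  finally have eq: "(cmod (cis \<tau> - of_real r))\<^sup>2 = (1 - r)\<^sup>2 + (2 * r) * (2 * ?s\<^sup>2)" .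
  have s: "1 * (2 * ?s\<^sup>2) \<le> (2 * r) * (2 * ?s\<^sup>2)"
    using assms by (intro mult_right_mono) auto
  have "(\<bar>\<tau>\<bar> / 2)\<^sup>2 \<le> (4 * ?s)\<^sup>2"
    using assms by (intro power_mono le_four_sin) auto
  then have "\<tau>\<^sup>2 \<le> 64 * ?s\<^sup>2"
    by (simp add: power_mult_distrib power_divide)
  also have "\<dots> \<le> 32 * ((2 * r) * (2 * ?s\<^sup>2))"
    using s by simp
  also have "\<dots> \<le> 32 * (cmod (cis \<tau> - of_real r))\<^sup>2"
    unfolding eq by simp
  finally have "\<tau>\<^sup>2 \<le> 32 * (cmod (cis \<tau> - of_real r))\<^sup>2" .
  moreover have "(1 - r)\<^sup>2 \<le> 32 * (cmod (cis \<tau> - of_real r))\<^sup>2"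
    unfolding eq using assms mult_nonneg_nonneg[of "2 * r" "2 * ?s\<^sup>2"] by simp
  ultimately show ?thesis
    by (simp add: max_def)
qed

lemma borel_measurable_modulus_of_continuity [measurable]:
  "modulus_of_continuity g \<in> borel_measurable borel"
  by (intro borel_measurable_mono_ennreal mono_modulus_of_continuity)

text \<open>
  Cauchy's formula is applied to \<open>u \<mapsto> F (- cis \<theta> * u) - F (cis \<theta>)\<close> at \<open>- r\<close>: with this rotation
  the point \<open>cis \<theta>\<close> corresponds to the midpoint of the parameter interval of the circle.
\<close>
lemma norm_deriv_le_modulus_of_continuity:
  assumes contF: "continuous_on (cball 0 1) F" and holF: "F holomorphic_on ball 0 1"
    and r: "1 / 2 \<le> r" "r < 1"
  shows "ennreal (cmod (deriv F (of_real r * cis \<theta>)))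
           \<le> 64 * (\<integral>\<^sup>+t\<in>{0<..pi}. ennreal (1 / (max (1 - r) t)\<^sup>2) * modulus_of_continuity F t \<partial>lborel)"
proof -
  let ?\<omega> = "modulus_of_continuity F"
  define G where "G = (\<lambda>u. F (- cis \<theta> * u) - F (cis \<theta>))"
  \<comment> \<open>Integrand of Cauchy's formula pulled back along \<open>cis (2 * pi * x)\<close>,
    including the derivative of the parametrisation.\<close>
  define h where "h = (\<lambda>x. G (cis (2 * pi * x)) / (cis (2 * pi * x) - - of_real r)\<^sup>2 * (2 * pi * \<i> * cis (2 * pi * x)))"
  \<comment> \<open>An even function of the angle. The factor 32 is that of
    \<open>norm_cis_minus_of_real_ge\<close>; the two halves of \<open>{- pi..pi}\<close> double it
    to the 64 of the conclusion.\<close>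
  define K where "K = (\<lambda>t. 32 * (ennreal (1 / (max (1 - r) \<bar>t\<bar>)\<^sup>2) * ?\<omega> \<bar>t\<bar>))"
  have [measurable]: "K \<in> borel_measurable borel"
    unfolding K_def by measurable
  have contG: "continuous_on (cball 0 1) G"
    unfolding G_def by (intro continuous_intros continuous_on_compose2[OF contF]) (auto simp: norm_mult)
  have holG: "G holomorphic_on ball 0 1"
  proof -
    have "(F \<circ> (\<lambda>u. - cis \<theta> * u)) holomorphic_on ball 0 1"
      by (intro holomorphic_on_compose_gen[OF _ holF] holomorphic_intros) (auto simp: norm_mult)
    then show ?thesis
      unfolding G_def o_def by (intro holomorphic_intros)
  qed
  have w: "- of_real r \<in> ball (0 :: complex) 1"
    using r by simp
  let ?CI = "contour_integral (circlepath 0 1) (\<lambda>u. G u / (u - - of_real r)\<^sup>2)"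
  have "(F has_field_derivative deriv F (of_real r * cis \<theta>)) (at (- cis \<theta> * - of_real r))"
    using r by (intro holomorphic_derivI[OF holF, THEN DERIV_cong_ev[THEN iffD1, rotated 3]]) (auto simp: norm_mult mult.commute)
  moreover have "((\<lambda>u. - cis \<theta> * u) has_field_derivative - cis \<theta>) (at (- of_real r))"
    by (auto intro!: derivative_eq_intros)
  ultimately have "((\<lambda>u. F (- cis \<theta> * u)) has_field_derivative deriv F (of_real r * cis \<theta>) * - cis \<theta>) (at (- of_real r))"
    by (rule DERIV_chain2)
  from DERIV_diff[OF this DERIV_const[of "F (cis \<theta>)"]]
  have "(G has_field_derivative deriv F (of_real r * cis \<theta>) * - cis \<theta>) (at (- of_real r))"
    by (simp add: G_def)
  moreover have "(G has_field_derivative 1 / (2 * of_real pi * \<i>) * ?CI) (at (- of_real r))"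
    using Cauchy_derivative_integral_circlepath(2)[OF contG holG w] .
  ultimately have "deriv F (of_real r * cis \<theta>) * - cis \<theta> = 1 / (2 * of_real pi * \<i>) * ?CI"
    by (rule DERIV_unique)
  then have "cmod (deriv F (of_real r * cis \<theta>) * - cis \<theta>) = cmod (1 / (2 * of_real pi * \<i>) * ?CI)"
    by (rule arg_cong)
  then have "cmod (deriv F (of_real r * cis \<theta>)) = cmod ?CI / (2 * pi)"
    by (simp add: norm_mult norm_divide)
  \<comment> \<open>The factor \<open>1 / (2 * pi)\<close> of Cauchy's formula is simply estimated
    by 1.\<close>
  also have "\<dots> \<le> cmod ?CI / 1"
    using pi_gt3 by (intro divide_left_mono) auto
  finally have deriv_le: "cmod (deriv F (of_real r * cis \<theta>)) \<le> cmod ?CI"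
    by simp
  have CI: "?CI = integral {0..1} h"
    unfolding contour_integral_integral vector_derivative_circlepath h_def
    by (simp add: circlepath cis_conv_exp mult_ac)
  have cis_shift: "cis (2 * pi * x) = - cis (2 * pi * x - pi)" for x
    by (simp add: complex_eq_iff cos_diff sin_diff)
  have ne: "cis (2 * pi * x) - - of_real r \<noteq> 0" for x
  proof
    assume "cis (2 * pi * x) - - of_real r = 0"
    then have "cis (2 * pi * x) = - of_real r"
      by (simp add: add_eq_0_iff2)
    then have "cmod (cis (2 * pi * x)) = cmod (- of_real r)"
      by (rule arg_cong)
    then show False
      using r by simp
  qed
  have "continuous_on {0..1} h"
    unfolding h_def using ne by (intro continuous_intros continuous_on_compose2[OF contG]) auto
  then have "ennreal (cmod ?CI) \<le> (\<integral>\<^sup>+x\<in>{0..1}. ennreal (cmod (h x)) \<partial>lborel)"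
    unfolding CI by (rule norm_integral_le_nn_integral)
  \<comment> \<open>The factor \<open>2 * pi\<close> in the speed of the parametrisation becomes the
    Jacobian of the substitution \<open>t = - pi + 2 * pi * x\<close>.\<close>
  also have "\<dots> \<le> (\<integral>\<^sup>+x. ennreal (2 * pi) * (K (- pi + 2 * pi * x) * indicator {- pi..pi} (- pi + 2 * pi * x)) \<partial>lborel)"
  proof (rule nn_integral_mono)
    fix x :: real
    define \<tau> where "\<tau> = - pi + 2 * pi * x"
    show "ennreal (cmod (h x)) * indicator {0..1} x
        \<le> ennreal (2 * pi) * (K (- pi + 2 * pi * x) * indicator {- pi..pi} (- pi + 2 * pi * x))"
    proof (cases "x \<in> {0..1}")
      case True
      then have \<tau>: "\<bar>\<tau>\<bar> \<le> pi"
        by (auto simp: \<tau>_def abs_le_iff)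
      let ?d = "cmod (F (cis (\<theta> + \<tau>)) - F (cis \<theta>))"
      let ?m = "max (1 - r) \<bar>\<tau>\<bar>"
      let ?q = "cmod (cis \<tau> - of_real r)"
      have m: "0 < ?m"
        using r by simp
      have mq: "?m\<^sup>2 \<le> 32 * ?q\<^sup>2"
        using norm_cis_minus_of_real_ge[OF r \<tau>] .
      have cis: "cis (2 * pi * x) = - cis \<tau>"
        unfolding cis_shift[of x] \<tau>_def by (simp add: algebra_simps)
      have q: "?q = cmod (cis (2 * pi * x) - - of_real r)"
        unfolding cis by (metis minus_diff_eq minus_minus norm_minus_cancel uminus_add_conv_diff diff_minus_eq_add)
      have "cmod (h x) = 2 * pi * (?d / ?q\<^sup>2)"
        unfolding h_def q G_def
        by (simp add: norm_mult norm_divide norm_power) (simp add: cis cis_mult)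
      also have "?d / ?q\<^sup>2 \<le> 32 * (1 / ?m\<^sup>2) * ?d"
      proof -
        have "0 < ?m\<^sup>2"
          using m by simp
        then have "0 < ?q\<^sup>2"
          using mq by linarith
        then have "1 / ?q\<^sup>2 \<le> 32 * (1 / ?m\<^sup>2)"
          using mq \<open>0 < ?m\<^sup>2\<close> by (simp add: field_simps)
        then have "1 / ?q\<^sup>2 * ?d \<le> 32 * (1 / ?m\<^sup>2) * ?d"
          by (rule mult_right_mono) simp
        then show ?thesis
          by simp
      qed
      finally have "ennreal (cmod (h x)) \<le> ennreal (2 * pi * (32 * (1 / ?m\<^sup>2) * ?d))"
        by (intro ennreal_leI) simp
      also have "\<dots> = ennreal (2 * pi) * (32 * (ennreal (1 / ?m\<^sup>2) * ennreal ?d))"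
      proof -
        have mult: "ennreal (2 * pi * (32 * a * d)) = ennreal (2 * pi) * (32 * (ennreal a * ennreal d))"
          if "0 \<le> a" "0 \<le> d" for a d
          using that by (simp add: ennreal_mult mult_ac)
        show ?thesis
          by (rule mult) auto
      qed
      also have "\<dots> \<le> ennreal (2 * pi) * K \<tau>"
        unfolding K_def by (intro mult_left_mono modulus_of_continuity_ge) auto
      finally show ?thesis
        using True \<tau> by (simp add: \<tau>_def abs_le_iff)
    qed auto
  qed
  also have "\<dots> = ennreal (2 * pi) * (\<integral>\<^sup>+x. K (- pi + 2 * pi * x) * indicator {- pi..pi} (- pi + 2 * pi * x) \<partial>lborel)"
    by (rule nn_integral_cmult) measurable
  also have "\<dots> = (\<integral>\<^sup>+t. K t * indicator {- pi..pi} t \<partial>lborel)"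
    by (subst nn_integral_real_affine[where c = "2 * pi" and t = "- pi"]) auto
  \<comment> \<open>The second summand is the reflection of the first, so that the substitution
    \<open>t \<mapsto> - t\<close> later identifies the two integrals. The point 0, missed by both,
    is null.\<close>
  also have "\<dots> \<le> (\<integral>\<^sup>+t. K t * indicator {0<..pi} t + K (0 + (- 1) * t) * indicator {0<..pi} (0 + (- 1) * t) \<partial>lborel)"
  proof (rule nn_integral_mono_AE)
    show "AE t in lborel. K t * indicator {- pi..pi} t
        \<le> K t * indicator {0<..pi} t + K (0 + (- 1) * t) * indicator {0<..pi} (0 + (- 1) * t)"
      using AE_lborel_singleton[of "0 :: real"]
    proof eventually_elim
      case (elim t)
      have "K (- t) = K t"
        by (simp add: K_def)
      then show ?case
        using elim by (cases "0 < t") (auto simp: indicator_def)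
    qed
  qed
  also have "\<dots> = (\<integral>\<^sup>+t\<in>{0<..pi}. K t \<partial>lborel) + (\<integral>\<^sup>+t. K (0 + (- 1) * t) * indicator {0<..pi} (0 + (- 1) * t) \<partial>lborel)"
    by (rule nn_integral_add) measurable
  also have "(\<integral>\<^sup>+t. K (0 + (- 1) * t) * indicator {0<..pi} (0 + (- 1) * t) \<partial>lborel) = (\<integral>\<^sup>+t\<in>{0<..pi}. K t \<partial>lborel)"
    by (subst (2) nn_integral_real_affine[where c = "- 1" and t = 0]) simp_all
  also have "(\<integral>\<^sup>+t\<in>{0<..pi}. K t \<partial>lborel) + (\<integral>\<^sup>+t\<in>{0<..pi}. K t \<partial>lborel) = 2 * (\<integral>\<^sup>+t\<in>{0<..pi}. K t \<partial>lborel)"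
    by (simp add: mult_2)
  also have "(\<integral>\<^sup>+t\<in>{0<..pi}. K t \<partial>lborel)
      = (\<integral>\<^sup>+t. 32 * (ennreal (1 / (max (1 - r) t)\<^sup>2) * ?\<omega> t * indicator {0<..pi} t) \<partial>lborel)"
    by (intro nn_integral_cong) (auto simp: K_def indicator_def)
  also have "\<dots> = 32 * (\<integral>\<^sup>+t\<in>{0<..pi}. ennreal (1 / (max (1 - r) t)\<^sup>2) * ?\<omega> t \<partial>lborel)"
    by (rule nn_integral_cmult) measurable
  finally have CI_le: "ennreal (cmod ?CI) \<le> 2 * (32 * (\<integral>\<^sup>+t\<in>{0<..pi}. ennreal (1 / (max (1 - r) t)\<^sup>2) * ?\<omega> t \<partial>lborel))" .
  have "ennreal (cmod (deriv F (of_real r * cis \<theta>))) \<le> ennreal (cmod ?CI)"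
    by (intro ennreal_leI deriv_le)
  also note CI_le
  finally show ?thesis
    by (simp add: mult.assoc[symmetric])
qed

section \<open>Construction of the majorant\<close>

text \<open>After Tonelli the inner integral over \<open>x\<close> is split at \<open>t\<close>. For
  \<open>x \<le> t\<close> the kernel is the constant \<open>1 / t\<^sup>2\<close> and
  \<open>nn_integral_ln_power_le\<close> applies; for larger \<open>x\<close> the logarithm is at
  most \<open>ln (1 / t)\<close> and the integral of \<open>1 / x\<^sup>2\<close> is at most
  \<open>1 / t\<close>.\<close>

lemma nn_integral_ln_power_kernel_le:
  fixes W :: "real \<Rightarrow> ennreal"
  assumes [measurable]: "W \<in> borel_measurable borel"
  shows "(\<integral>\<^sup>+x\<in>{0<..<1}. ennreal (ln (1 / x) ^ n) * (\<integral>\<^sup>+t\<in>{0<..<1}. ennreal (1 / (max x t)\<^sup>2) * W t \<partial>lborel) \<partial>lborel)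
           \<le> (\<integral>\<^sup>+t\<in>{0<..<1}. ennreal (((ln (1 / t) + n) ^ n + ln (1 / t) ^ n) / t) * W t \<partial>lborel)"
proof -
  define K where "K = (\<lambda>x t. ennreal (ln (1 / x) ^ n) * indicator {0<..<1} x *
    (ennreal (1 / (max x t)\<^sup>2) * W t * indicator {0<..<1} t))"
  have K: "case_prod K \<in> borel_measurable (lborel \<Otimes>\<^sub>M lborel)"
    unfolding K_def by measurable
  have "(\<integral>\<^sup>+x\<in>{0<..<1}. ennreal (ln (1 / x) ^ n) * (\<integral>\<^sup>+t\<in>{0<..<1}. ennreal (1 / (max x t)\<^sup>2) * W t \<partial>lborel) \<partial>lborel)
      = (\<integral>\<^sup>+x. \<integral>\<^sup>+t. K x t \<partial>lborel \<partial>lborel)"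
  proof (rule nn_integral_cong)
    fix x :: real
    have "(\<integral>\<^sup>+t. K x t \<partial>lborel) = ennreal (ln (1 / x) ^ n) * indicator {0<..<1} x *
        (\<integral>\<^sup>+t\<in>{0<..<1}. ennreal (1 / (max x t)\<^sup>2) * W t \<partial>lborel)"
      unfolding K_def by (rule nn_integral_cmult) measurable
    then show "ennreal (ln (1 / x) ^ n) * (\<integral>\<^sup>+t\<in>{0<..<1}. ennreal (1 / (max x t)\<^sup>2) * W t \<partial>lborel) * indicator {0<..<1} x
        = (\<integral>\<^sup>+t. K x t \<partial>lborel)"
      by (simp only: mult_ac)
  qed
  also have "\<dots> = (\<integral>\<^sup>+t. \<integral>\<^sup>+x. K x t \<partial>lborel \<partial>lborel)"
    by (rule lborel_pair.Fubini'[OF K, symmetric])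
  also have "\<dots> \<le> (\<integral>\<^sup>+t\<in>{0<..<1}. ennreal (((ln (1 / t) + n) ^ n + ln (1 / t) ^ n) / t) * W t \<partial>lborel)"
  proof (rule nn_integral_mono)
    fix t :: real
    show "(\<integral>\<^sup>+x. K x t \<partial>lborel) \<le> ennreal (((ln (1 / t) + n) ^ n + ln (1 / t) ^ n) / t) * W t * indicator {0<..<1} t"
    proof (cases "t \<in> {0<..<1}")
      case True
      let ?L = "ln (1 / t)"
      have L: "0 \<le> ?L"
        using True by simp
      let ?A = "\<lambda>x. ennreal (1 / t\<^sup>2) * W t * (ennreal (ln (1 / x) ^ n) * indicator {0<..t} x)"
      let ?B = "\<lambda>x. ennreal (?L ^ n) * W t * (ennreal (1 / x\<^sup>2) * indicator {t..1} x)"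
      have "(\<integral>\<^sup>+x. K x t \<partial>lborel) \<le> (\<integral>\<^sup>+x. ?A x + ?B x \<partial>lborel)"
      proof (rule nn_integral_mono)
        fix x :: real
        show "K x t \<le> ?A x + ?B x"
        proof (cases "x \<in> {0<..<1}")
          case x: True
          show ?thesis
          proof (cases "x \<le> t")
            case le: True
            have "K x t = ?A x"
              using x le True by (simp add: K_def max_def mult_ac)
            then show ?thesis
              by simp
          next
            case False
            have "ennreal (ln (1 / x) ^ n) \<le> ennreal (?L ^ n)"
              using x False True by (intro ennreal_leI power_mono) (auto simp: ln_div)
            then have "ennreal (ln (1 / x) ^ n) * (ennreal (1 / x\<^sup>2) * W t) \<le> ennreal (?L ^ n) * (ennreal (1 / x\<^sup>2) * W t)"
              by (rule mult_right_mono) simp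
            then have "K x t \<le> ?B x"
              using x False True by (simp add: K_def max_def mult_ac)
            then show ?thesis
              by (rule order_trans) simp
          qed
        qed (auto simp: K_def)
      qed
      also have "\<dots> = (\<integral>\<^sup>+x. ?A x \<partial>lborel) + (\<integral>\<^sup>+x. ?B x \<partial>lborel)"
        by (rule nn_integral_add) measurable
      also have "(\<integral>\<^sup>+x. ?A x \<partial>lborel) = ennreal (1 / t\<^sup>2) * W t * (\<integral>\<^sup>+x\<in>{0<..t}. ennreal (ln (1 / x) ^ n) \<partial>lborel)"
        by (rule nn_integral_cmult) measurable
      also have "(\<integral>\<^sup>+x. ?B x \<partial>lborel) = ennreal (?L ^ n) * W t * (\<integral>\<^sup>+x\<in>{t..1}. ennreal (1 / x\<^sup>2) \<partial>lborel)"
        by (rule nn_integral_cmult) measurable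
      also have "ennreal (1 / t\<^sup>2) * W t * (\<integral>\<^sup>+x\<in>{0<..t}. ennreal (ln (1 / x) ^ n) \<partial>lborel)
            + ennreal (?L ^ n) * W t * (\<integral>\<^sup>+x\<in>{t..1}. ennreal (1 / x\<^sup>2) \<partial>lborel)
          \<le> ennreal (1 / t\<^sup>2) * W t * ennreal (t * (?L + n) ^ n) + ennreal (?L ^ n) * W t * ennreal (1 / t)"
        using True
        by (intro add_mono mult_left_mono nn_integral_ln_power_le nn_integral_inverse_square_le) auto
      also have "\<dots> = (ennreal (1 / t\<^sup>2) * ennreal (t * (?L + n) ^ n) + ennreal (?L ^ n) * ennreal (1 / t)) * W t"
        by (simp only: distrib_right) (simp only: mult_ac)
      also have "ennreal (1 / t\<^sup>2) * ennreal (t * (?L + n) ^ n) + ennreal (?L ^ n) * ennreal (1 / t)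
          = ennreal (1 / t\<^sup>2 * (t * (?L + n) ^ n) + ?L ^ n * (1 / t))"
        using True L by (subst (1 2) ennreal_mult[symmetric]) (auto simp flip: ennreal_plus)
      also have "1 / t\<^sup>2 * (t * (?L + n) ^ n) + ?L ^ n * (1 / t) = ((?L + n) ^ n + ?L ^ n) / t"
        using True by (simp add: power2_eq_square add_divide_distrib)
      finally show ?thesis
        using True by simp
    qed (simp add: K_def)
  qed
  finally show ?thesis .
qed

text \<open>Removes the shift by \<open>n\<close> inside the logarithmic power, leaving a pure power
  and a constant: the log-Dini weights with exponents \<open>n\<close> and 0. The proof compares
  \<open>a + b\<close> with twice the maximum.\<close>

lemma power_sum_shift_le:
  fixes a b :: real
  assumes "0 \<le> a" "0 \<le> b"
  shows "(a + b) ^ n + a ^ n \<le> 2 * 2 ^ n * (a ^ n + b ^ n)"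
proof -
  have "(a + b) ^ n \<le> (2 * max a b) ^ n"
    using assms by (intro power_mono) auto
  also have "\<dots> = 2 ^ n * max a b ^ n"
    by (rule power_mult_distrib)
  also have "\<dots> \<le> 2 ^ n * (a ^ n + b ^ n)"
    using assms by (intro mult_left_mono) (auto simp: max_def)
  finally have "(a + b) ^ n \<le> 2 ^ n * (a ^ n + b ^ n)" .
  moreover have "a ^ n \<le> (a + b) ^ n"
    using assms by (intro power_mono) auto
  ultimately show ?thesis
    by simp
qed

text \<open>The majorant is the bound of \<open>norm_deriv_le_modulus_of_continuity\<close>, which
  requires radii of at least 1/2, whence \<open>r0 = 1 / 2\<close>. Its integral is cut down to
  \<open>t < 1\<close>, the range of the log-Dini condition; the rest goes into the constant
  \<open>C\<close>.\<close>

lemma log_Dini_majorant_exists: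
  assumes hol: "f holomorphic_on ball 0 1" and ext: "continuous_extension_to_closed_disc f F"
    and Dini: "log_Dini_continuous F"
  obtains \<Phi> where "log_Dini_majorant f (1 / 2) \<Phi>"
proof -
  let ?\<omega> = "modulus_of_continuity F"
  obtain B where B: "0 \<le> B" "\<And>z. cmod z = 1 \<Longrightarrow> cmod (F z) \<le> B"
    using continuous_extension_bounded[OF ext] by blast
  have contF: "continuous_on (cball 0 1) F" and Ff: "\<And>z. z \<in> ball 0 1 \<Longrightarrow> F z = f z"
    using ext by (auto simp: continuous_extension_to_closed_disc_def)
  have holF: "F holomorphic_on ball 0 1"
    using holomorphic_transform[OF hol] Ff by metis
  have Dini': "(\<integral>\<^sup>+t\<in>{0<..<1}. ennreal (ln (1 / t) ^ n) * (ennreal (1 / t) * ?\<omega> t) \<partial>lborel) < \<infinity>" for n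
  proof -
    have "(\<integral>\<^sup>+t\<in>{0<..<1}. ennreal (ln (1 / t) ^ n) * (ennreal (1 / t) * ?\<omega> t) \<partial>lborel)
        = (\<integral>\<^sup>+t. ennreal (ln (1 / t) ^ n) * (?\<omega> t / ennreal t) \<partial>lebesgue_on {0<..<1})"
      unfolding nn_integral_lebesgue_on[OF borel_open[OF open_greaterThanLessThan]]
      by (intro nn_integral_cong) (auto simp: divide_ennreal_conv_mult indicator_def)
    then show ?thesis
      using Dini by (simp add: log_Dini_continuous_def)
  qed
  \<comment> \<open>The part over \<open>{1..pi}\<close> is at most
    \<open>64 * (2 * B) * 3 = 384 * B\<close>: there the kernel is at most 1, the modulus at most
    \<open>2 * B\<close>, and the interval lies in \<open>{1..4}\<close>. The summand 1 makes the
    majorant positive.\<close>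
  define C where "C = 1 + 384 * B"
  define I where "I = (\<lambda>x. \<integral>\<^sup>+t\<in>{0<..<1}. ennreal (1 / (max x t)\<^sup>2) * ?\<omega> t \<partial>lborel)"
  define \<Phi> where "\<Phi> = (\<lambda>x. ennreal C + 64 * I x)"
  have C: "1 \<le> C"
    using B by (simp add: C_def)
  \<comment> \<open>This holds on the whole line, also for negative \<open>x\<close>, because
    \<open>max x t\<close> is positive for every \<open>t\<close> in the range of
    integration.\<close>
  have "antimono I"
  proof (rule antimonoI)
    fix x y :: real
    assume "x \<le> y"
    then show "I y \<le> I x"
      unfolding I_def
      by (intro nn_integral_set_mono mult_right_mono ennreal_leI divide_left_mono power_mono mult_pos_pos zero_less_power) auto
  qed
  then have anti: "antimono \<Phi>"
    by (auto simp: \<Phi>_def antimono_def intro!: add_left_mono mult_left_mono)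
  have [measurable]: "I \<in> borel_measurable borel" "\<Phi> \<in> borel_measurable borel"
    using anti \<open>antimono I\<close> by (simp_all add: borel_measurable_antimono_ennreal)
  have L1: "L1_on {0..<1 / 2} (\<lambda>x. ennreal (ln (1 / x) ^ n) * \<Phi> x)" for n
    unfolding L1_on_def
  proof
    show "(\<lambda>x. ennreal (ln (1 / x) ^ n) * \<Phi> x) \<in> borel_measurable (lebesgue_on {0..<1 / 2})"
      by (intro measurable_restrict_space1 measurable_completion) measurable
    have "(\<integral>\<^sup>+x. ennreal (ln (1 / x) ^ n) * \<Phi> x \<partial>lebesgue_on {0..<1 / 2})
        = (\<integral>\<^sup>+x\<in>{0..<1 / 2}. ennreal (ln (1 / x) ^ n) * \<Phi> x \<partial>lborel)"
      by (simp add: nn_integral_lebesgue_on)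
    also have "\<dots> \<le> (\<integral>\<^sup>+x\<in>{0..1}. ennreal (ln (1 / x) ^ n) * \<Phi> x \<partial>lborel)"
      by (intro nn_integral_set_mono) auto
    also have "\<dots> = (\<integral>\<^sup>+x. ennreal C * (ennreal (ln (1 / x) ^ n) * indicator {0<..1} x)
        + 64 * (ennreal (ln (1 / x) ^ n) * I x * indicator {0<..<1} x) \<partial>lborel)"
      using AE_lborel_singleton[of "0 :: real"] AE_lborel_singleton[of "1 :: real"]
      by (intro nn_integral_cong_AE, eventually_elim)
         (auto simp: \<Phi>_def indicator_def distrib_left mult_ac)
    also have "\<dots> = (\<integral>\<^sup>+x. ennreal C * (ennreal (ln (1 / x) ^ n) * indicator {0<..1} x) \<partial>lborel)
        + (\<integral>\<^sup>+x. 64 * (ennreal (ln (1 / x) ^ n) * I x * indicator {0<..<1} x) \<partial>lborel)"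
      by (rule nn_integral_add) measurable
    also have "(\<integral>\<^sup>+x. ennreal C * (ennreal (ln (1 / x) ^ n) * indicator {0<..1} x) \<partial>lborel)
        = ennreal C * (\<integral>\<^sup>+x\<in>{0<..1}. ennreal (ln (1 / x) ^ n) \<partial>lborel)"
      by (rule nn_integral_cmult) measurable
    also have "(\<integral>\<^sup>+x. 64 * (ennreal (ln (1 / x) ^ n) * I x * indicator {0<..<1} x) \<partial>lborel)
        = 64 * (\<integral>\<^sup>+x\<in>{0<..<1}. ennreal (ln (1 / x) ^ n) * I x \<partial>lborel)"
      by (rule nn_integral_cmult) measurable
    \<comment> \<open>\<open>nn_integral_ln_power_le\<close> is used at \<open>t = 1\<close>, where
      the logarithm vanishes and a finite constant remains.\<close>
    also have "ennreal C * (\<integral>\<^sup>+x\<in>{0<..1}. ennreal (ln (1 / x) ^ n) \<partial>lborel)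
          + 64 * (\<integral>\<^sup>+x\<in>{0<..<1}. ennreal (ln (1 / x) ^ n) * I x \<partial>lborel)
        \<le> ennreal C * ennreal (1 * (ln (1 / 1) + n) ^ n)
          + 64 * (\<integral>\<^sup>+t\<in>{0<..<1}. ennreal (((ln (1 / t) + n) ^ n + ln (1 / t) ^ n) / t) * ?\<omega> t \<partial>lborel)"
      unfolding I_def
      by (intro add_mono mult_left_mono nn_integral_ln_power_le nn_integral_ln_power_kernel_le) auto
    also have "\<dots> < \<infinity>"
    proof -
      \<comment> \<open>\<open>?J m\<close> is the log-Dini integrand with exponent
        \<open>m\<close>; the exponents \<open>n\<close> and 0 suffice after
        \<open>power_sum_shift_le\<close>.\<close>
      let ?J = "\<lambda>m t. ennreal (ln (1 / t) ^ m) * (ennreal (1 / t) * ?\<omega> t) * indicator {0<..<1} t"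
      let ?c = "ennreal (2 * 2 ^ n)"
      have "(\<integral>\<^sup>+t\<in>{0<..<1}. ennreal (((ln (1 / t) + n) ^ n + ln (1 / t) ^ n) / t) * ?\<omega> t \<partial>lborel)
          \<le> (\<integral>\<^sup>+t. ?c * ?J n t + ?c * ennreal (real n ^ n) * ?J 0 t \<partial>lborel)"
      proof (rule nn_integral_mono)
        fix t :: real
        let ?L = "ln (1 / t)"
        show "ennreal (((?L + n) ^ n + ?L ^ n) / t) * ?\<omega> t * indicator {0<..<1} t
            \<le> ?c * ?J n t + ?c * ennreal (real n ^ n) * ?J 0 t"
        proof (cases "t \<in> {0<..<1}")
          case True
          then have L: "0 \<le> ?L"
            by simp
          have "((?L + n) ^ n + ?L ^ n) / t \<le> 2 * 2 ^ n * (?L ^ n + real n ^ n) / t"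
            using True L by (intro divide_right_mono power_sum_shift_le) auto
          also have "\<dots> = 2 * 2 ^ n * ?L ^ n * (1 / t) + 2 * 2 ^ n * real n ^ n * (1 / t)"
            by (simp add: field_simps add_divide_distrib)
          finally have "ennreal (((?L + n) ^ n + ?L ^ n) / t)
              \<le> ennreal (2 * 2 ^ n * ?L ^ n * (1 / t) + 2 * 2 ^ n * real n ^ n * (1 / t))"
            by (rule ennreal_leI)
          also have "\<dots> = ennreal (2 * 2 ^ n * ?L ^ n * (1 / t)) + ennreal (2 * 2 ^ n * real n ^ n * (1 / t))"
            using True L by (intro ennreal_plus) auto
          also have "ennreal (2 * 2 ^ n * ?L ^ n * (1 / t)) = ?c * ennreal (?L ^ n) * ennreal (1 / t)"
            using True L by (subst ennreal_mult[symmetric], simp, simp)+ simp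
          also have "ennreal (2 * 2 ^ n * real n ^ n * (1 / t)) = ?c * ennreal (real n ^ n) * ennreal (1 / t)"
            using True by (subst ennreal_mult[symmetric], simp, simp)+ simp
          finally have "ennreal (((?L + n) ^ n + ?L ^ n) / t) * ?\<omega> t
              \<le> (?c * ennreal (?L ^ n) * ennreal (1 / t) + ?c * ennreal (real n ^ n) * ennreal (1 / t)) * ?\<omega> t"
            by (rule mult_right_mono) simp
          also have "\<dots> = ?c * (ennreal (?L ^ n) * (ennreal (1 / t) * ?\<omega> t))
              + ?c * ennreal (real n ^ n) * (ennreal (1 / t) * ?\<omega> t)"
            by (simp only: distrib_right mult.assoc)
          finally show ?thesis
            using True by simp
        qed simp
      qed
      also have "\<dots> = (\<integral>\<^sup>+t. ?c * ?J n t \<partial>lborel) + (\<integral>\<^sup>+t. ?c * ennreal (real n ^ n) * ?J 0 t \<partial>lborel)"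
        by (rule nn_integral_add) measurable
      also have "(\<integral>\<^sup>+t. ?c * ?J n t \<partial>lborel) = ?c * (\<integral>\<^sup>+t. ?J n t \<partial>lborel)"
        by (rule nn_integral_cmult) measurable
      also have "(\<integral>\<^sup>+t. ?c * ennreal (real n ^ n) * ?J 0 t \<partial>lborel) = ?c * ennreal (real n ^ n) * (\<integral>\<^sup>+t. ?J 0 t \<partial>lborel)"
        by (rule nn_integral_cmult) measurable
      also have "?c * (\<integral>\<^sup>+t. ?J n t \<partial>lborel) + ?c * ennreal (real n ^ n) * (\<integral>\<^sup>+t. ?J 0 t \<partial>lborel) < \<infinity>"
        using Dini'[of n] Dini'[of 0] by (simp add: ennreal_mult_less_top del: power_0)
      finally show ?thesis
        by (simp add: ennreal_mult_less_top)
    qed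
    finally show "(\<integral>\<^sup>+x. ennreal (ln (1 / x) ^ n) * \<Phi> x \<partial>lebesgue_on {0..<1 / 2}) < \<infinity>" .
  qed
  have bound: "ennreal (cmod (deriv f (of_real r * cis \<theta>))) \<le> \<Phi> (1 - r)" if r: "r \<in> {1 - 1 / 2<..<1}" for r \<theta>
  proof -
    let ?g = "\<lambda>t. ennreal (1 / (max (1 - r) t)\<^sup>2) * ?\<omega> t"
    have "deriv f (of_real r * cis \<theta>) = deriv F (of_real r * cis \<theta>)"
      using r Ff by (intro complex_derivative_transform_within_open[OF hol holF open_ball]) (auto simp: norm_mult)
    then have "ennreal (cmod (deriv f (of_real r * cis \<theta>))) \<le> 64 * (\<integral>\<^sup>+t\<in>{0<..pi}. ?g t \<partial>lborel)"
      using norm_deriv_le_modulus_of_continuity[OF contF holF] r by simp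
    also have "(\<integral>\<^sup>+t\<in>{0<..pi}. ?g t \<partial>lborel)
        \<le> (\<integral>\<^sup>+t. ?g t * indicator {0<..<1} t + ennreal (2 * B) * indicator {1..4} t \<partial>lborel)"
    proof (rule nn_integral_mono)
      fix t :: real
      show "?g t * indicator {0<..pi} t \<le> ?g t * indicator {0<..<1} t + ennreal (2 * B) * indicator {1..4} t"
      proof (cases "t \<in> {1..pi}")
        case True
        have "1 ^ 2 \<le> (max (1 - r) t)\<^sup>2"
          using True by (intro power_mono) auto
        then have "1 / (max (1 - r) t)\<^sup>2 \<le> 1"
          by (simp add: divide_le_eq)
        then have "?g t \<le> ennreal 1 * ennreal (2 * B)"
          using B by (intro mult_mono ennreal_leI modulus_of_continuity_bounded) auto
        then show ?thesis
          using True pi_less_4 by (simp add: indicator_def)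
      next
        case False
        then show ?thesis
          by (auto simp: indicator_def)
      qed
    qed
    also have "\<dots> = I (1 - r) + ennreal (2 * B) * ennreal 3"
      by (simp add: I_def nn_integral_add nn_integral_cmult_indicator)
    finally have "ennreal (cmod (deriv f (of_real r * cis \<theta>))) \<le> 64 * (I (1 - r) + ennreal (2 * B) * ennreal 3)"
      by (simp add: mult_left_mono)
    also have "\<dots> = ennreal (384 * B) + 64 * I (1 - r)"
      using B by (simp add: distrib_left ennreal_mult add.commute mult_ac)
    also have "\<dots> \<le> \<Phi> (1 - r)"
      unfolding \<Phi>_def C_def by (intro add_right_mono ennreal_leI) simp
    finally show ?thesis .
  qed
  have "log_Dini_majorant f (1 / 2) \<Phi>"
    unfolding log_Dini_majorant_def
  proof (intro conjI ballI allI)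
    show "0 < \<Phi> x" for x
      using C by (simp add: \<Phi>_def add_pos_nonneg)
    show "antimono_on {0..<1 / 2} \<Phi>"
      using anti by (auto simp: antimono_def monotone_on_def)
  qed (use L1 bound in auto)
  then show ?thesis
    by (rule that)
qed

theorem theorem2p3:
  fixes f :: "complex \<Rightarrow> complex"
  assumes "f holomorphic_on ball 0 1"
  shows "((\<exists>F. continuous_extension_to_closed_disc f F \<and> log_Dini_continuous F)
            \<longleftrightarrow> (\<exists>r0 \<Phi>. log_Dini_majorant f r0 \<Phi>))
       \<and> (\<forall>r0 \<Phi> F. log_Dini_majorant f r0 \<Phi> \<and> continuous_extension_to_closed_disc f F \<longrightarrow>
            (\<forall>\<delta>. 0 \<le> \<delta> \<and> \<delta> < r0 \<longrightarrow>
               modulus_of_continuity F \<delta> \<le> 3 * (\<integral>\<^sup>+ x. \<Phi> x \<partial>lebesgue_on {0..\<delta>})))"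
proof (intro conjI iffI allI impI)
  assume "\<exists>F. continuous_extension_to_closed_disc f F \<and> log_Dini_continuous F"
  then show "\<exists>r0 \<Phi>. log_Dini_majorant f r0 \<Phi>"
    using log_Dini_majorant_exists[OF assms] by metis
next
  assume "\<exists>r0 \<Phi>. log_Dini_majorant f r0 \<Phi>"
  then show "\<exists>F. continuous_extension_to_closed_disc f F \<and> log_Dini_continuous F"
    using continuous_extension_exists[OF assms] log_Dini_continuous_if_majorant[OF assms] by metis
next
  fix r0 \<Phi> F \<delta>
  assume "log_Dini_majorant f r0 \<Phi> \<and> continuous_extension_to_closed_disc f F" "0 \<le> \<delta> \<and> \<delta> < r0"
  then show "modulus_of_continuity F \<delta> \<le> 3 * (\<integral>\<^sup>+ x. \<Phi> x \<partial>lebesgue_on {0..\<delta>})"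
    using modulus_of_continuity_le_majorant[OF assms] by (auto simp: nn_integral_lebesgue_on)
qed

end
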